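(* Let $P$ be a Borel probability measure on $\mathbb{R}^d$ such that $\int\|x\|^s\,\mathrm{d}P(x) < \infty$ and $\dim^*_{\mathsf{SW}_1}(P) < s$ for some $s\in(2,\infty)$. Then $$\mathbb{E}\big[ \mathsf{W}_1 (P_n,P) \big] \leq C n^{-1/s}$$ for all $n$, where $C$ is a constant independent of $n$.
   Context: $\|\cdot\|$ is the Euclidean norm. $\mathsf{W}_1$ is the 1-Wasserstein distance on $\mathbb{R}^d$ (Euclidean cost). $P_n$ is the empirical measure of $n$ i.i.d. samples from $P$. $N(\epsilon,S,\|\cdot\|)$ is the $\epsilon$-covering number of $S\subset\mathbb{R}^d$. The $(\epsilon,\tau)$-covering number of $P$ is $N_\epsilon(P,\tau):=\inf\{N(\epsilon,S,\|\cdot\|): S\subset\mathbb{R}^d\text{ Borel},\ P(S)\ge1-\tau\}$, and $d_\epsilon(P,\tau):=-\log N_\epsilon(P,\tau)/\log\epsilon$. The upper smooth 1-Wasserstein dimension is $\dim^*_{\mathsf{SW}_1}(P):=\inf\{s\in(2,\infty): \limsup_{\epsilon\to0}d_\epsilon(P,\epsilon^{s^2/(s-2)})\le s\}$. *)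

theory Defs
  imports "HOL-Probability.Probability"
begin

definition couplings :: "'a measure \<Rightarrow> 'a measure \<Rightarrow> ('a \<times> 'a) measure set" where
  "couplings M N =
     {\<gamma>. sets \<gamma> = sets (M \<Otimes>\<^sub>M N) \<and> distr \<gamma> M fst = M \<and> distr \<gamma> N snd = N}"

definition wasserstein1 :: "'a::real_normed_vector measure \<Rightarrow> 'a measure \<Rightarrow> ennreal" where
  "wasserstein1 M N = (INF \<gamma>\<in>couplings M N. \<integral>\<^sup>+ z. ennreal (norm (fst z - snd z)) \<partial>\<gamma>)"

text \<open>The empirical measure of \<open>x 0, \<dots>, x (n - 1)\<close>: the image of the uniform distribution on
  the indices. It is a probability measure for \<open>n > 0\<close> only.\<close>

definition empirical_measure :: "nat \<Rightarrow> (nat \<Rightarrow> 'a::topological_space) \<Rightarrow> 'a measure" where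
  "empirical_measure n x = distr (uniform_count_measure {..<n}) borel x"

lemma measure_empirical_measure:
  assumes "A \<in> sets borel"
  shows "measure (empirical_measure n x) A = real (card {i. i < n \<and> x i \<in> A}) / real n"
proof -
  have "x -` A \<inter> {..<n} = {i. i < n \<and> x i \<in> A}"
    by auto
  moreover have "{i. i < n \<and> x i \<in> A} \<subseteq> {..<n}"
    by auto
  ultimately show ?thesis
    using assms unfolding empirical_measure_def
    by (subst measure_distr)
       (auto simp: measurable_def sets_uniform_count_measure space_uniform_count_measure
         measure_uniform_count_measure)
qed

text \<open>Minimal number of closed balls of radius \<open>\<epsilon>\<close>, with centres anywhere in the space,
  that cover \<open>S\<close>; it is \<open>\<infinity>\<close> if no finite cover exists.\<close>

definition covering_number :: "real \<Rightarrow> 'a::metric_space set \<Rightarrow> enat" where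
  "covering_number \<epsilon> S = (INF C\<in>{C. finite C \<and> S \<subseteq> (\<Union>c\<in>C. cball c \<epsilon>)}. enat (card C))"

definition measure_covering_number :: "real \<Rightarrow> 'a::metric_space measure \<Rightarrow> real \<Rightarrow> enat" where
  "measure_covering_number \<epsilon> P \<tau> =
     (INF S\<in>{S \<in> sets borel. measure P S \<ge> 1 - \<tau>}. covering_number \<epsilon> S)"

definition ln_enat :: "enat \<Rightarrow> ereal" where
  "ln_enat N = (case N of enat k \<Rightarrow> if k = 0 then -\<infinity> else ereal (ln (real k)) | \<infinity> \<Rightarrow> \<infinity>)"

definition covering_dim :: "real \<Rightarrow> 'a::metric_space measure \<Rightarrow> real \<Rightarrow> ereal" where
  "covering_dim \<epsilon> P \<tau> = - ln_enat (measure_covering_number \<epsilon> P \<tau>) / ereal (ln \<epsilon>)"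

text \<open>Taken in \<^typ>\<open>ereal\<close>, so that the infimum of the empty set is \<open>\<infinity>\<close>.\<close>

definition upper_SW1_dim :: "'a::metric_space measure \<Rightarrow> ereal" where
  "upper_SW1_dim P =
     Inf {ereal s | s. 2 < s \<and>
       Limsup (at_right 0) (\<lambda>\<epsilon>. covering_dim \<epsilon> P (\<epsilon> powr (s\<^sup>2 / (s - 2)))) \<le> ereal s}"

definition iid_samples :: "'w measure \<Rightarrow> nat \<Rightarrow> (nat \<Rightarrow> 'w \<Rightarrow> 'a::topological_space) \<Rightarrow> 'a measure \<Rightarrow> bool"
  where
  "iid_samples M n X P \<longleftrightarrow>
     prob_space M \<and> prob_space.indep_vars M (\<lambda>_. borel) X {..<n} \<and>
     (\<forall>i<n. distr M borel (X i) = P)"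

end

theory Submission
  imports Defs
begin

text \<open>Chaining, carried out with couplings instead of Lipschitz functions. Cover \<open>P\<close> up to mass
  \<open>e\<^sub>k powr \<beta>\<close> by balls of radius \<open>e\<^sub>k = e\<^sub>0 / 4 ^ k\<close>, project successively from the finest level
  \<open>K\<close> to the origin at level \<open>0\<close>, and read the resulting tree of centres as a transport network:
  \<open>W\<^sub>1(P\<^sub>n, P)\<close> is at most the projection error at level \<open>K\<close> plus the sum over tree edges of
  length times \<open>\<bar>P\<^sub>n(F) - P(F)\<bar>\<close>, with \<open>F\<close> the cell below the edge. Since the mean square of
  \<open>P\<^sub>n(F) - P(F)\<close> is at most \<open>P(F) / n\<close>, Cauchy--Schwarz bounds level \<open>k\<close> by
  \<open>sqrt (N\<^sub>k / n)\<close> times the \<open>L\<^sup>2\<close> norm of the projection step. The moment condition and the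
  size of \<open>\<beta> = t\<^sup>2 / (t - 2)\<close> make the uncovered part contribute only \<open>O(e\<^sub>k)\<close> to that norm.
  With \<open>e\<^sub>K\<close> of order \<open>n powr (- 1 / s)\<close> the resulting sum is geometric.\<close>

subsection \<open>Discrete transport plans\<close>

text \<open>Projecting level by level, instead of sending each point directly to its nearest centre
  on every level, makes the cells nest; only then is the net flow conserved at every node of the
  tree. The price is that projection errors accumulate. The ratio 4 between scales is chosen so that
  they add up to at most \<open>2 * e k\<close>.

  Couplings bound \<open>W_1\<close> from above straight from its definition, without duality.
  Cancelling the common mass is essential there: otherwise an edge would cost the sum of the two
  cell masses instead of their difference, and nothing would decay in \<open>n\<close>.
  Cauchy--Schwarz is used as a weighted inequality between products and squares, which is linear in
  the squared deviations and so passes through expectations in \<open>ennreal\<close> without square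
  roots.

  Three exponents are in play: one below the dimension bound fixes the uncovered mass, a slightly
  larger one \<open>t\<close> counts centres, and \<open>s\<close> gives moment and rate. A level
  costs about \<open>e k powr (1 - t / 2) * n powr (- 1 / 2)\<close>; with \<open>s\<close> in place
  of \<open>t\<close> this is of order \<open>n powr (- 1 / s)\<close> at the finest level, and the
  gap between \<open>t\<close> and \<open>s\<close> pays for summing over levels.\<close>

definition transport_plan :: "'a set \<Rightarrow> ('a \<Rightarrow> real) \<Rightarrow> ('a \<Rightarrow> real) \<Rightarrow> ('a \<Rightarrow> 'a \<Rightarrow> real) \<Rightarrow> bool" where
  "transport_plan A p q w \<longleftrightarrow>
     (\<forall>x\<in>A. \<forall>y\<in>A. 0 \<le> w x y) \<and> (\<forall>x\<in>A. (\<Sum>y\<in>A. w x y) = p x) \<and> (\<forall>y\<in>A. (\<Sum>x\<in>A. w x y) = q y)"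

definition transport_cost :: "'a::metric_space set \<Rightarrow> ('a \<Rightarrow> 'a \<Rightarrow> real) \<Rightarrow> real" where
  "transport_cost A w = (\<Sum>x\<in>A. \<Sum>y\<in>A. w x y * dist x y)"

lemma transport_plan_nonneg:
  assumes "transport_plan A p q w" "x \<in> A" "y \<in> A"
  shows "0 \<le> w x y"
  using assms by (auto simp: transport_plan_def)

text \<open>Makes \<open>x / 0 = 0\<close> harmless below: wherever a mass is divided by a vanishing
  marginal, the plan entry multiplying it vanishes as well.\<close>

lemma transport_plan_eq_0:
  assumes "transport_plan A p q w" "finite A" "x \<in> A" "y \<in> A" "p x = 0 \<or> q y = 0"
  shows "w x y = 0"
proof (cases "p x = 0")
  case True
  then have "(\<Sum>y\<in>A. w x y) = 0" using assms by (auto simp: transport_plan_def)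
  then show ?thesis
    using assms sum_nonneg_eq_0_iff[of A "w x"] by (auto simp: transport_plan_def)
next
  case False
  then have "(\<Sum>x\<in>A. w x y) = 0" using assms by (auto simp: transport_plan_def)
  then show ?thesis
    using assms sum_nonneg_eq_0_iff[of A "\<lambda>x. w x y"] by (auto simp: transport_plan_def)
qed

lemma transport_plan_swap:
  "transport_plan A p q w \<Longrightarrow> transport_plan A q p (\<lambda>x y. w y x)"
  by (auto simp: transport_plan_def)

lemma sum_fibres:
  fixes f :: "'b \<Rightarrow> 'c::comm_semiring_0"
  assumes "finite A" "finite B" "\<rho> ` A \<subseteq> B"
  shows "(\<Sum>x\<in>A. g (\<rho> x) * f x) = (\<Sum>u\<in>B. g u * (\<Sum>x | x \<in> A \<and> \<rho> x = u. f x))"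
proof -
  have "(\<Sum>x\<in>A. g (\<rho> x) * f x) = (\<Sum>u\<in>B. \<Sum>x | x \<in> A \<and> \<rho> x = u. g (\<rho> x) * f x)"
    using sum.group[OF assms, of "\<lambda>x. g (\<rho> x) * f x"] by simp
  also have "\<dots> = (\<Sum>u\<in>B. g u * (\<Sum>x | x \<in> A \<and> \<rho> x = u. f x))"
    by (intro sum.cong refl) (auto simp: sum_distrib_left intro!: sum.cong)
  finally show ?thesis .
qed

text \<open>\<open>a x / a' (\<rho> x)\<close> is the conditional mass of \<open>x\<close> in its
  fibre, so coarse mass is split over a pair of fibres as a product. The conditional masses of
  \<open>y\<close> sum to 1 over each fibre of positive mass, which leaves a row sum of
  \<open>w\<close>. The column marginal is the same fact for the swapped plan.\<close>

lemma transport_refine_marginal: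
  fixes a b :: "'a \<Rightarrow> real"
  assumes fin: "finite A" "finite B" "\<rho> ` A \<subseteq> B"
    and b: "\<And>x. x \<in> A \<Longrightarrow> 0 \<le> b x"
    and a: "\<And>x. x \<in> A \<Longrightarrow> 0 \<le> a x"
    and a': "\<And>u. u \<in> B \<Longrightarrow> a' u = (\<Sum>x | x \<in> A \<and> \<rho> x = u. a x)"
    and b': "\<And>u. u \<in> B \<Longrightarrow> b' u = (\<Sum>x | x \<in> A \<and> \<rho> x = u. b x)"
    and w: "transport_plan B a' b' w"
    and x: "x \<in> A"
  shows "(\<Sum>y\<in>A. w (\<rho> x) (\<rho> y) * (a x / a' (\<rho> x)) * (b y / b' (\<rho> y))) = a x"
proof -
  have \<rho>x: "\<rho> x \<in> B" using fin x by auto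
  have "(\<Sum>y\<in>A. w (\<rho> x) (\<rho> y) * (a x / a' (\<rho> x)) * (b y / b' (\<rho> y)))
    = (\<Sum>y\<in>A. (w (\<rho> x) (\<rho> y) * (a x / a' (\<rho> x)) / b' (\<rho> y)) * b y)"
    by (intro sum.cong) auto
  also have "\<dots> = (\<Sum>v\<in>B. (w (\<rho> x) v * (a x / a' (\<rho> x)) / b' v) * b' v)"
    by (subst sum_fibres[OF fin, of "\<lambda>v. w (\<rho> x) v * (a x / a' (\<rho> x)) / b' v"])
      (auto intro!: sum.cong simp: b')
  also have "\<dots> = (\<Sum>v\<in>B. w (\<rho> x) v) * (a x / a' (\<rho> x))"
    unfolding sum_distrib_right
    using transport_plan_eq_0[OF w \<open>finite B\<close> \<rho>x] by (intro sum.cong) auto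
  also have "\<dots> = a' (\<rho> x) * (a x / a' (\<rho> x))"
    using w \<rho>x by (auto simp: transport_plan_def)
  \<comment> \<open>A fibre without mass forces \<open>a x = 0\<close>, in agreement with the value
    0 that the left side then takes.\<close>
  also have "\<dots> = a x"
  proof (cases "a' (\<rho> x) = 0")
    case True
    then have "(\<Sum>y | y \<in> A \<and> \<rho> y = \<rho> x. a y) = 0" using a'[OF \<rho>x] by simp
    then have "a x = 0"
      using sum_nonneg_eq_0_iff[of "{y. y \<in> A \<and> \<rho> y = \<rho> x}" a] fin a x by auto
    then show ?thesis by simp
  qed simp
  finally show ?thesis .
qed

text \<open>Mass travels from \<open>x\<close> to \<open>\<rho> x\<close>, along the coarse plan to
  \<open>\<rho> y\<close>, and on to \<open>y\<close>. By the triangle inequality the cost splits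
  into three legs: the outer two see one marginal each, and the middle one is exactly the coarse
  cost.\<close>

lemma transport_refine:
  fixes a b :: "'a::metric_space \<Rightarrow> real"
  assumes fin: "finite A" "finite B" "\<rho> ` A \<subseteq> B"
    and a: "\<And>x. x \<in> A \<Longrightarrow> 0 \<le> a x"
    and b: "\<And>x. x \<in> A \<Longrightarrow> 0 \<le> b x"
    and a': "\<And>u. u \<in> B \<Longrightarrow> a' u = (\<Sum>x | x \<in> A \<and> \<rho> x = u. a x)"
    and b': "\<And>u. u \<in> B \<Longrightarrow> b' u = (\<Sum>x | x \<in> A \<and> \<rho> x = u. b x)"
    and w': "transport_plan B a' b' w'"
  shows "\<exists>w. transport_plan A a b w \<and>
    transport_cost A w \<le> (\<Sum>x\<in>A. dist x (\<rho> x) * (a x + b x)) + transport_cost B w'"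
proof -
  define w where "w x y = w' (\<rho> x) (\<rho> y) * (a x / a' (\<rho> x)) * (b y / b' (\<rho> y))" for x y
  have a'0: "0 \<le> a' u" if "u \<in> B" for u using that a' by (auto intro!: sum_nonneg a)
  have b'0: "0 \<le> b' u" if "u \<in> B" for u using that b' by (auto intro!: sum_nonneg b)
  have \<rho>B: "\<rho> x \<in> B" if "x \<in> A" for x using that fin by auto
  have w0: "0 \<le> w x y" if "x \<in> A" "y \<in> A" for x y
    unfolding w_def using that \<rho>B a b a'0 b'0 transport_plan_nonneg[OF w']
    by (intro mult_nonneg_nonneg divide_nonneg_nonneg) auto
  have m1: "(\<Sum>y\<in>A. w x y) = a x" if "x \<in> A" for x
    unfolding w_def using transport_refine_marginal[OF fin b a a' b' w' that] .
  have m2: "(\<Sum>x\<in>A. w x y) = b y" if "y \<in> A" for y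
  proof -
    have "(\<Sum>x\<in>A. w x y) = (\<Sum>x\<in>A. w' (\<rho> x) (\<rho> y) * (b y / b' (\<rho> y)) * (a x / a' (\<rho> x)))"
      unfolding w_def by (intro sum.cong) (simp_all add: ac_simps)
    also have "\<dots> = b y"
      using transport_refine_marginal[OF fin a b b' a' transport_plan_swap[OF w'] that] .
    finally show ?thesis .
  qed
  have plan: "transport_plan A a b w"
    using w0 m1 m2 by (auto simp: transport_plan_def)
  have inner: "(\<Sum>y\<in>A. (w' u (\<rho> y) / a' u / b' (\<rho> y) * dist u (\<rho> y)) * b y)
    = (\<Sum>v\<in>B. (w' u v / a' u / b' v * dist u v) * b' v)" for u
    by (subst sum_fibres[OF fin, of "\<lambda>v. w' u v / a' u / b' v * dist u v"])
      (auto intro!: sum.cong simp: b')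
  have mid: "(\<Sum>x\<in>A. \<Sum>y\<in>A. w x y * dist (\<rho> x) (\<rho> y)) = transport_cost B w'"
  proof -
    have "(\<Sum>x\<in>A. \<Sum>y\<in>A. w x y * dist (\<rho> x) (\<rho> y))
      = (\<Sum>x\<in>A. (\<Sum>y\<in>A. (w' (\<rho> x) (\<rho> y) / a' (\<rho> x) / b' (\<rho> y) * dist (\<rho> x) (\<rho> y)) * b y) * a x)"
      unfolding w_def sum_distrib_right by (intro sum.cong refl) auto
    also have "\<dots> = (\<Sum>x\<in>A. (\<Sum>v\<in>B. (w' (\<rho> x) v / a' (\<rho> x) / b' v * dist (\<rho> x) v) * b' v) * a x)"
      by (simp only: inner)
    also have "\<dots> = (\<Sum>u\<in>B. (\<Sum>v\<in>B. (w' u v / a' u / b' v * dist u v) * b' v) * a' u)"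
      by (subst sum_fibres[OF fin, where g="\<lambda>u. \<Sum>v\<in>B. (w' u v / a' u / b' v * dist u v) * b' v"])
         (auto intro!: sum.cong simp: a')
    also have "\<dots> = transport_cost B w'"
      unfolding transport_cost_def sum_distrib_right
      using transport_plan_eq_0[OF w' \<open>finite B\<close>] by (intro sum.cong refl) force
    finally show ?thesis .
  qed
  have "transport_cost A w \<le>
      (\<Sum>x\<in>A. \<Sum>y\<in>A. w x y * dist x (\<rho> x) + w x y * dist y (\<rho> y) + w x y * dist (\<rho> x) (\<rho> y))"
    unfolding transport_cost_def
  proof (intro sum_mono)
    fix x y assume xy: "x \<in> A" "y \<in> A"
    have "dist x y \<le> dist x (\<rho> x) + dist y (\<rho> y) + dist (\<rho> x) (\<rho> y)"
      using dist_triangle[of x y "\<rho> x"] dist_triangle[of "\<rho> x" y "\<rho> y"] dist_commute[of "\<rho> y" y] by linarith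
    from mult_left_mono[OF this w0[OF xy]]
    show "w x y * dist x y \<le> w x y * dist x (\<rho> x) + w x y * dist y (\<rho> y) + w x y * dist (\<rho> x) (\<rho> y)"
      by (simp add: algebra_simps)
  qed
  also have "\<dots> = (\<Sum>x\<in>A. \<Sum>y\<in>A. w x y * dist x (\<rho> x)) + (\<Sum>x\<in>A. \<Sum>y\<in>A. w x y * dist y (\<rho> y))
      + transport_cost B w'"
    by (simp add: sum.distrib mid)
  also have "(\<Sum>x\<in>A. \<Sum>y\<in>A. w x y * dist x (\<rho> x)) = (\<Sum>x\<in>A. a x * dist x (\<rho> x))"
    by (simp add: sum_distrib_right[symmetric] m1)
  also have "(\<Sum>x\<in>A. \<Sum>y\<in>A. w x y * dist y (\<rho> y)) = (\<Sum>y\<in>A. b y * dist y (\<rho> y))"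
    by (subst sum.swap) (simp add: sum_distrib_right[symmetric] m2)
  finally show ?thesis using plan
    by (intro exI[of _ w]) (simp add: sum.distrib[symmetric] algebra_simps)
qed

text \<open>Common mass stays in place, so only the net flow \<open>D (Suc i) z\<close> has to be carried along
  the tree edge from \<open>z\<close> to its parent \<open>\<rho> i z\<close>.\<close>

lemma tree_transport:
  fixes Z :: "nat \<Rightarrow> 'a::metric_space set"
  assumes "\<And>i. i \<le> k \<Longrightarrow> finite (Z i)" "Z 0 = {c}" "D 0 c = 0"
    and "\<And>i. i < k \<Longrightarrow> \<rho> i ` Z (Suc i) \<subseteq> Z i"
    and "\<And>i u. i < k \<Longrightarrow> u \<in> Z i \<Longrightarrow> D i u = (\<Sum>z | z \<in> Z (Suc i) \<and> \<rho> i z = u. D (Suc i) z)"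
    and "\<And>z. z \<in> Z k \<Longrightarrow> 0 \<le> p z" "\<And>z. z \<in> Z k \<Longrightarrow> 0 \<le> q z"
    and "\<And>z. z \<in> Z k \<Longrightarrow> D k z = p z - q z"
  shows "\<exists>w. transport_plan (Z k) p q w \<and>
    transport_cost (Z k) w \<le> (\<Sum>i<k. \<Sum>z\<in>Z (Suc i). dist z (\<rho> i z) * \<bar>D (Suc i) z\<bar>)"
  using assms
proof (induction k arbitrary: p q)
  \<comment> \<open>With a single point, \<open>D 0 c = 0\<close> amounts to
    \<open>p c = q c\<close>, and all mass stays at \<open>c\<close>.\<close>
  case 0
  then show ?case
    by (intro exI[of _ "\<lambda>x y. p c"]) (auto simp: transport_plan_def transport_cost_def)
next
  case (Suc k)
  define m where "m z = min (p z) (q z)" for z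
  define a where "a z = p z - m z" for z
  define b where "b z = q z - m z" for z
  define a' where "a' u = (\<Sum>z | z \<in> Z (Suc k) \<and> \<rho> k z = u. a z)" for u
  define b' where "b' u = (\<Sum>z | z \<in> Z (Suc k) \<and> \<rho> k z = u. b z)" for u
  have fin: "finite (Z (Suc k))" "finite (Z k)" "\<rho> k ` Z (Suc k) \<subseteq> Z k"
    using Suc.prems by auto
  have ab: "0 \<le> a z" "0 \<le> b z" for z by (auto simp: a_def b_def m_def)
  \<comment> \<open>\<open>a\<close> and \<open>b\<close> are the positive and negative parts of the
    net flow, so a cost in terms of \<open>a + b\<close> is one in terms of its absolute
    value.\<close>
  have absD: "a z + b z = \<bar>D (Suc k) z\<bar>" if "z \<in> Z (Suc k)" for z
    using Suc.prems(8)[OF that] by (auto simp: a_def b_def m_def)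
  \<comment> \<open>The residual masses pushed to level \<open>k\<close> are not the
    level-\<open>k\<close> masses of \<open>p\<close> and \<open>q\<close>, only their difference is
    the same; hence the induction over arbitrary \<open>p\<close> and \<open>q\<close>.\<close>
  have "\<exists>w. transport_plan (Z k) a' b' w \<and>
    transport_cost (Z k) w \<le> (\<Sum>i<k. \<Sum>z\<in>Z (Suc i). dist z (\<rho> i z) * \<bar>D (Suc i) z\<bar>)"
  proof (rule Suc.IH)
    show "D k z = a' z - b' z" if "z \<in> Z k" for z
    proof -
      have "D k z = (\<Sum>y | y \<in> Z (Suc k) \<and> \<rho> k y = z. D (Suc k) y)"
        using Suc.prems(5)[of k z] that by simp
      also have "\<dots> = (\<Sum>y | y \<in> Z (Suc k) \<and> \<rho> k y = z. a y - b y)"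
        using Suc.prems(8) by (intro sum.cong) (auto simp: a_def b_def)
      finally show ?thesis by (simp add: sum_subtractf a'_def b'_def)
    qed
  qed (use Suc.prems ab in \<open>auto simp: a'_def b'_def intro!: sum_nonneg\<close>)
  then obtain w' where w': "transport_plan (Z k) a' b' w'"
    and cw': "transport_cost (Z k) w' \<le> (\<Sum>i<k. \<Sum>z\<in>Z (Suc i). dist z (\<rho> i z) * \<bar>D (Suc i) z\<bar>)"
    by blast
  obtain w where w: "transport_plan (Z (Suc k)) a b w"
    and cw: "transport_cost (Z (Suc k)) w
      \<le> (\<Sum>x\<in>Z (Suc k). dist x (\<rho> k x) * (a x + b x)) + transport_cost (Z k) w'"
    using transport_refine[OF fin _ _ _ _ w', of a b] ab by (auto simp: a'_def b'_def)
  define v where "v x y = w x y + (if x = y then m x else 0)" for x y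
  have "transport_plan (Z (Suc k)) p q v"
    using w Suc.prems(6,7) fin unfolding transport_plan_def v_def
    by (auto simp: sum.distrib sum.delta sum.delta' a_def b_def m_def intro!: add_nonneg_nonneg)
  moreover have "transport_cost (Z (Suc k)) v = transport_cost (Z (Suc k)) w"
    unfolding transport_cost_def v_def by (intro sum.cong refl) auto
  moreover have "(\<Sum>x\<in>Z (Suc k). dist x (\<rho> k x) * (a x + b x))
    = (\<Sum>x\<in>Z (Suc k). dist x (\<rho> k x) * \<bar>D (Suc k) x\<bar>)"
    using absD by (intro sum.cong) auto
  ultimately show ?case using cw cw' by (intro exI[of _ v]) (auto simp: add.commute)
qed

subsection \<open>From discrete plans to couplings\<close>

lemma nn_integral_fibres:
  assumes "finite Z" "\<And>x. x \<in> space M \<Longrightarrow> \<pi> x \<in> Z" "simple_function M \<pi>"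
  shows "(\<integral>\<^sup>+x. f (\<pi> x) \<partial>M) = (\<Sum>v\<in>Z. f v * emeasure M {x \<in> space M. \<pi> x = v})"
proof -
  have meas: "{x \<in> space M. \<pi> x = v} \<in> sets M" for v
    using simple_functionD(2)[OF assms(3), of "{v}"] by (simp add: vimage_def Int_def conj_commute)
  have "(\<integral>\<^sup>+x. f (\<pi> x) \<partial>M)
    = (\<integral>\<^sup>+x. (\<Sum>v\<in>Z. f v * indicator {x \<in> space M. \<pi> x = v} x) \<partial>M)"
  proof (intro nn_integral_cong)
    fix x assume "x \<in> space M"
    then show "f (\<pi> x) = (\<Sum>v\<in>Z. f v * indicator {x \<in> space M. \<pi> x = v} x)"
      using assms(1,2) by (subst sum.remove[of Z "\<pi> x"]) (auto intro!: sum.neutral)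
  qed
  also have "\<dots> = (\<Sum>v\<in>Z. f v * emeasure M {x \<in> space M. \<pi> x = v})"
    using meas by (subst nn_integral_sum) (auto simp: nn_integral_cmult_indicator)
  finally show ?thesis .
qed

lemma simple_function_compose_measurable:
  assumes "g \<in> measurable M N" "simple_function N f"
  shows "simple_function M (\<lambda>x. f (g x))"
proof -
  have "(\<lambda>x. f (g x)) ` space M \<subseteq> f ` space N"
    using measurable_space[OF assms(1)] by auto
  moreover have "(\<lambda>x. f (g x)) -` {y} \<inter> space M \<in> sets M" for y
  proof -
    have "(\<lambda>x. f (g x)) -` {y} \<inter> space M = g -` (f -` {y} \<inter> space N) \<inter> space M"
      using measurable_space[OF assms(1)] by auto
    then show ?thesis using assms measurable_sets simple_functionD(2) by metis
  qed
  ultimately show ?thesis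
    using simple_functionD(1)[OF assms(2)] unfolding simple_function_def
    by (auto intro: finite_subset)
qed

text \<open>Cell \<open>v\<close> contributes \<open>w u v / (?a * b v) * b v\<close>, that is
  \<open>w u v / ?a\<close>, and the row sum of the plan is \<open>?a\<close>. This is one marginal
  condition for the coupling built below; the swapped plan gives the other.\<close>

lemma lifted_plan_row:
  assumes plan: "transport_plan Z (\<lambda>z. measure \<mu> {x \<in> space \<mu>. \<pi> x = z}) b w"
    and "finite Z" "u \<in> Z" "prob_space \<mu>"
    and b: "\<And>v. b v = measure \<nu> {x \<in> space \<nu>. \<pi> x = v}"
    and \<nu>: "prob_space \<nu>" "simple_function \<nu> \<pi>" "\<And>x. x \<in> space \<nu> \<Longrightarrow> \<pi> x \<in> Z"
    and pos: "measure \<mu> {x \<in> space \<mu>. \<pi> x = u} \<noteq> 0" (is "?a \<noteq> 0")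
  shows "(\<integral>\<^sup>+y. ennreal (w u (\<pi> y) / (?a * b (\<pi> y))) \<partial>\<nu>) = 1"
proof -
  interpret \<nu>: prob_space \<nu> by fact
  have "0 \<le> ?a" by simp
  with pos have a: "0 < ?a" by linarith
  have b0: "0 \<le> b v" for v by (simp add: b)
  have w0: "0 \<le> w u v" if "v \<in> Z" for v using transport_plan_nonneg[OF plan \<open>u \<in> Z\<close> that] .
  have "(\<integral>\<^sup>+y. ennreal (w u (\<pi> y) / (?a * b (\<pi> y))) \<partial>\<nu>)
    = (\<Sum>v\<in>Z. ennreal (w u v / (?a * b v)) * emeasure \<nu> {x \<in> space \<nu>. \<pi> x = v})"
    using nn_integral_fibres[OF \<open>finite Z\<close> \<nu>(3,2), of "\<lambda>v. ennreal (w u v / (?a * b v))"] by simp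
  also have "\<dots> = (\<Sum>v\<in>Z. ennreal (w u v / ?a))"
  proof (intro sum.cong refl)
    fix v assume v: "v \<in> Z"
    have "ennreal (w u v / (?a * b v)) * emeasure \<nu> {x \<in> space \<nu>. \<pi> x = v}
      = ennreal (w u v / (?a * b v)) * ennreal (b v)"
      by (simp add: b \<nu>.emeasure_eq_measure)
    also have "\<dots> = ennreal (w u v / (?a * b v) * b v)"
      using b0 w0[OF v] a by (subst ennreal_mult) auto
    also have "w u v / (?a * b v) * b v = w u v / ?a"
      using transport_plan_eq_0[OF plan \<open>finite Z\<close> \<open>u \<in> Z\<close> v] by (cases "b v = 0") auto
    finally show "ennreal (w u v / (?a * b v)) * emeasure \<nu> {x \<in> space \<nu>. \<pi> x = v} = ennreal (w u v / ?a)" .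
  qed
  also have "\<dots> = ennreal ((\<Sum>v\<in>Z. w u v) / ?a)"
    using w0 a by (subst sum_ennreal) (auto simp: sum_divide_distrib)
  also have "(\<Sum>v\<in>Z. w u v) = ?a" using plan \<open>u \<in> Z\<close> by (auto simp: transport_plan_def)
  finally show ?thesis using pos by simp
qed

text \<open>Finitely many null fibres have a null union. The normalisation of the coupling density
  breaks down only there, hence holds almost everywhere.\<close>

lemma AE_fibre_pos:
  assumes "prob_space \<mu>" "simple_function \<mu> \<pi>" "finite Z" "\<And>x. x \<in> space \<mu> \<Longrightarrow> \<pi> x \<in> Z"
  shows "AE x in \<mu>. measure \<mu> {y \<in> space \<mu>. \<pi> y = \<pi> x} \<noteq> 0"
proof -
  interpret prob_space \<mu> by fact
  have meas: "{x \<in> space \<mu>. \<pi> x = v} \<in> sets \<mu>" for v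
    using simple_functionD(2)[OF assms(2), of "{v}"] by (simp add: vimage_def Int_def conj_commute)
  have "AE x in \<mu>. \<pi> x = v \<longrightarrow> measure \<mu> {y \<in> space \<mu>. \<pi> y = v} \<noteq> 0" for v
  proof (cases "measure \<mu> {y \<in> space \<mu>. \<pi> y = v} = 0")
    case True
    then have "{y \<in> space \<mu>. \<pi> y = v} \<in> null_sets \<mu>"
      using meas by (auto simp: emeasure_eq_measure)
    then show ?thesis by (rule AE_I') auto
  qed simp
  then have "AE x in \<mu>. \<forall>v\<in>Z. \<pi> x = v \<longrightarrow> measure \<mu> {y \<in> space \<mu>. \<pi> y = v} \<noteq> 0"
    using \<open>finite Z\<close> by (intro AE_finite_allI) auto
  then show ?thesis using assms(4) by (auto elim: AE_mp)
qed

text \<open>The coupling has density \<open>w (\<pi> x) (\<pi> y) / (\<mu>(\<pi> = \<pi> x) \<nu>(\<pi> = \<pi> y))\<close> with respect to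
  the product measure.\<close>

lemma wasserstein1_le_transport_cost:
  fixes \<mu> \<nu> :: "'a::{real_normed_vector, second_countable_topology} measure"
  assumes \<mu>: "prob_space \<mu>" "sets \<mu> = sets borel" and \<nu>: "prob_space \<nu>" "sets \<nu> = sets borel"
    and \<pi>: "\<pi> \<in> borel_measurable borel" "range \<pi> \<subseteq> Z" and fin: "finite Z"
    and plan: "transport_plan Z (\<lambda>z. measure \<mu> {x. \<pi> x = z}) (\<lambda>z. measure \<nu> {x. \<pi> x = z}) w"
  shows "wasserstein1 \<mu> \<nu> \<le> (\<integral>\<^sup>+x. ennreal (dist x (\<pi> x)) \<partial>\<mu>) + (\<integral>\<^sup>+x. ennreal (dist x (\<pi> x)) \<partial>\<nu>)
    + ennreal (transport_cost Z w)"
proof -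
  interpret \<mu>: prob_space \<mu> by fact
  interpret \<nu>: prob_space \<nu> by fact
  interpret pair_prob_space \<mu> \<nu> ..
  have [simp]: "space \<mu> = UNIV" "space \<nu> = UNIV"
    using sets_eq_imp_space_eq[OF \<mu>(2)] sets_eq_imp_space_eq[OF \<nu>(2)] by auto
  note [measurable_cong] = \<mu>(2) \<nu>(2)
  note [measurable] = \<pi>(1)
  have \<pi>Z: "\<pi> x \<in> Z" for x using \<pi>(2) by auto
  have "finite (range \<pi>)" using \<pi>(2) fin finite_subset by blast
  then have simp: "simple_function \<mu> \<pi>" "simple_function \<nu> \<pi>"
    by (auto intro!: simple_function_borel_measurable)
  define a where "a u = measure \<mu> {x. \<pi> x = u}" for u
  define b where "b u = measure \<nu> {x. \<pi> x = u}" for u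
  have plan': "transport_plan Z a b w" using plan by (simp add: a_def[abs_def] b_def[abs_def])
  define h where "h u v = w u v / (a u * b v)" for u v
  have h0: "0 \<le> h u v" if "u \<in> Z" "v \<in> Z" for u v
    using transport_plan_nonneg[OF plan' that] by (auto simp: h_def a_def b_def)
  have s1: "simple_function (\<mu> \<Otimes>\<^sub>M \<nu>) (\<lambda>z. \<pi> (fst z))"
    by (rule simple_function_compose_measurable[OF _ simp(1)]) simp
  have s2: "simple_function (\<mu> \<Otimes>\<^sub>M \<nu>) (\<lambda>z. \<pi> (snd z))"
    by (rule simple_function_compose_measurable[OF _ simp(2)]) simp
  have h[measurable]: "(\<lambda>z. ennreal (h (\<pi> (fst z)) (\<pi> (snd z)))) \<in> borel_measurable (\<mu> \<Otimes>\<^sub>M \<nu>)"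
    using simple_function_compose2[OF s1 s2, of "\<lambda>u v. ennreal (h u v)"]
    by (rule borel_measurable_simple_function)
  define \<gamma> where "\<gamma> = density (\<mu> \<Otimes>\<^sub>M \<nu>) (\<lambda>z. ennreal (h (\<pi> (fst z)) (\<pi> (snd z))))"
  have sets\<gamma>[measurable_cong]: "sets \<gamma> = sets (\<mu> \<Otimes>\<^sub>M \<nu>)" by (simp add: \<gamma>_def)
  have row: "AE x in \<mu>. (\<integral>\<^sup>+y. ennreal (h (\<pi> x) (\<pi> y)) \<partial>\<nu>) = 1"
    using AE_fibre_pos[OF \<mu>(1) simp(1) fin \<pi>Z]
  proof (rule AE_mp, intro AE_I2 impI)
    fix x assume "measure \<mu> {y \<in> space \<mu>. \<pi> y = \<pi> x} \<noteq> 0"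
    with lifted_plan_row[of Z \<mu> \<pi> b w "\<pi> x" \<nu>] show "(\<integral>\<^sup>+y. ennreal (h (\<pi> x) (\<pi> y)) \<partial>\<nu>) = 1"
      using plan' \<mu> \<nu> simp fin \<pi>Z by (simp add: a_def[abs_def] b_def h_def)
  qed
  have col: "AE y in \<nu>. (\<integral>\<^sup>+x. ennreal (h (\<pi> x) (\<pi> y)) \<partial>\<mu>) = 1"
    using AE_fibre_pos[OF \<nu>(1) simp(2) fin \<pi>Z]
  proof (rule AE_mp, intro AE_I2 impI)
    fix y assume "measure \<nu> {x \<in> space \<nu>. \<pi> x = \<pi> y} \<noteq> 0"
    with lifted_plan_row[of Z \<nu> \<pi> a "\<lambda>x y. w y x" "\<pi> y" \<mu>]
    show "(\<integral>\<^sup>+x. ennreal (h (\<pi> x) (\<pi> y)) \<partial>\<mu>) = 1"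
      using transport_plan_swap[OF plan'] \<mu> \<nu> simp fin \<pi>Z
      by (simp add: a_def b_def[abs_def] h_def mult.commute)
  qed
  \<comment> \<open>The marginals are recorded as integral identities: on indicators they show that
    \<open>\<gamma>\<close> is a coupling, on \<open>dist x (\<pi> x)\<close> they evaluate the two
    outer legs of the transport.\<close>
  have fst_int: "(\<integral>\<^sup>+z. f (fst z) \<partial>\<gamma>) = (\<integral>\<^sup>+x. f x \<partial>\<mu>)" if [measurable]: "f \<in> borel_measurable borel" for f
  proof -
    have "(\<integral>\<^sup>+z. f (fst z) \<partial>\<gamma>) = (\<integral>\<^sup>+z. ennreal (h (\<pi> (fst z)) (\<pi> (snd z))) * f (fst z) \<partial>(\<mu> \<Otimes>\<^sub>M \<nu>))"
      unfolding \<gamma>_def by (subst nn_integral_density) auto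
    also have "\<dots> = (\<integral>\<^sup>+x. \<integral>\<^sup>+y. ennreal (h (\<pi> x) (\<pi> y)) * f x \<partial>\<nu> \<partial>\<mu>)"
      by (subst \<nu>.nn_integral_fst[symmetric]) auto
    also have "\<dots> = (\<integral>\<^sup>+x. (\<integral>\<^sup>+y. ennreal (h (\<pi> x) (\<pi> y)) \<partial>\<nu>) * f x \<partial>\<mu>)"
    proof (intro nn_integral_cong nn_integral_multc)
      fix x
      show "(\<lambda>y. ennreal (h (\<pi> x) (\<pi> y))) \<in> borel_measurable \<nu>"
        using simple_function_compose1[OF simp(2), of "\<lambda>v. ennreal (h (\<pi> x) v)"]
        by (rule borel_measurable_simple_function)
    qed
    also have "\<dots> = (\<integral>\<^sup>+x. f x \<partial>\<mu>)"
      using row by (intro nn_integral_cong_AE) auto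
    finally show ?thesis .
  qed
  have snd_int: "(\<integral>\<^sup>+z. f (snd z) \<partial>\<gamma>) = (\<integral>\<^sup>+x. f x \<partial>\<nu>)" if [measurable]: "f \<in> borel_measurable borel" for f
  proof -
    have "(\<integral>\<^sup>+z. f (snd z) \<partial>\<gamma>) = (\<integral>\<^sup>+z. ennreal (h (\<pi> (fst z)) (\<pi> (snd z))) * f (snd z) \<partial>(\<mu> \<Otimes>\<^sub>M \<nu>))"
      unfolding \<gamma>_def by (subst nn_integral_density) auto
    also have "\<dots> = (\<integral>\<^sup>+y. \<integral>\<^sup>+x. ennreal (h (\<pi> x) (\<pi> y)) * f y \<partial>\<mu> \<partial>\<nu>)"
      by (subst nn_integral_snd[symmetric]) (auto simp: case_prod_beta)
    also have "\<dots> = (\<integral>\<^sup>+y. (\<integral>\<^sup>+x. ennreal (h (\<pi> x) (\<pi> y)) \<partial>\<mu>) * f y \<partial>\<nu>)"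
    proof (intro nn_integral_cong nn_integral_multc)
      fix y
      show "(\<lambda>x. ennreal (h (\<pi> x) (\<pi> y))) \<in> borel_measurable \<mu>"
        using simple_function_compose1[OF simp(1), of "\<lambda>u. ennreal (h u (\<pi> y))"]
        by (rule borel_measurable_simple_function)
    qed
    also have "\<dots> = (\<integral>\<^sup>+x. f x \<partial>\<nu>)"
      using col by (intro nn_integral_cong_AE) auto
    finally show ?thesis .
  qed
  have "distr \<gamma> \<mu> fst = \<mu>"
  proof (rule measure_eqI)
    fix A assume "A \<in> sets (distr \<gamma> \<mu> fst)"
    then have A[measurable]: "A \<in> sets borel" using \<mu> by simp
    have "emeasure (distr \<gamma> \<mu> fst) A = (\<integral>\<^sup>+z. indicator A z \<partial>(distr \<gamma> \<mu> fst))"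
      using A \<mu> by (subst nn_integral_indicator) auto
    also have "\<dots> = (\<integral>\<^sup>+z. indicator A (fst z) \<partial>\<gamma>)"
      by (subst nn_integral_distr) auto
    finally show "emeasure (distr \<gamma> \<mu> fst) A = emeasure \<mu> A"
      using fst_int[of "indicator A"] A \<mu> by simp
  qed simp
  moreover have "distr \<gamma> \<nu> snd = \<nu>"
  proof (rule measure_eqI)
    fix A assume "A \<in> sets (distr \<gamma> \<nu> snd)"
    then have A[measurable]: "A \<in> sets borel" using \<nu> by simp
    have "emeasure (distr \<gamma> \<nu> snd) A = (\<integral>\<^sup>+z. indicator A z \<partial>(distr \<gamma> \<nu> snd))"
      using A \<nu> by (subst nn_integral_indicator) auto
    also have "\<dots> = (\<integral>\<^sup>+z. indicator A (snd z) \<partial>\<gamma>)"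
      by (subst nn_integral_distr) auto
    finally show "emeasure (distr \<gamma> \<nu> snd) A = emeasure \<nu> A"
      using snd_int[of "indicator A"] A \<nu> by simp
  qed simp
  ultimately have "\<gamma> \<in> couplings \<mu> \<nu>"
    using sets\<gamma> by (simp add: couplings_def)
  then have "wasserstein1 \<mu> \<nu> \<le> (\<integral>\<^sup>+z. ennreal (norm (fst z - snd z)) \<partial>\<gamma>)"
    unfolding wasserstein1_def by (rule INF_lower)
  also have "\<dots> \<le> (\<integral>\<^sup>+z. ennreal (dist (fst z) (\<pi> (fst z))) + ennreal (dist (snd z) (\<pi> (snd z)))
      + ennreal (dist (\<pi> (fst z)) (\<pi> (snd z))) \<partial>\<gamma>)"
  proof (intro nn_integral_mono)
    fix z :: "'a \<times> 'a"
    have "norm (fst z - snd z) \<le> dist (fst z) (\<pi> (fst z)) + dist (snd z) (\<pi> (snd z))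
      + dist (\<pi> (fst z)) (\<pi> (snd z))"
      using dist_triangle[of "fst z" "snd z" "\<pi> (fst z)"]
        dist_triangle[of "\<pi> (fst z)" "snd z" "\<pi> (snd z)"] dist_commute[of "\<pi> (snd z)" "snd z"]
      by (simp add: dist_norm[symmetric])
    then show "ennreal (norm (fst z - snd z)) \<le> ennreal (dist (fst z) (\<pi> (fst z)))
      + ennreal (dist (snd z) (\<pi> (snd z))) + ennreal (dist (\<pi> (fst z)) (\<pi> (snd z)))"
      by (simp add: ennreal_plus[symmetric] ennreal_leI del: ennreal_plus)
  qed
  also have "\<dots> = (\<integral>\<^sup>+z. ennreal (dist (fst z) (\<pi> (fst z))) \<partial>\<gamma>) + (\<integral>\<^sup>+z. ennreal (dist (snd z) (\<pi> (snd z))) \<partial>\<gamma>)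
      + (\<integral>\<^sup>+z. ennreal (dist (\<pi> (fst z)) (\<pi> (snd z))) \<partial>\<gamma>)"
    by (subst nn_integral_add, simp, simp, subst nn_integral_add) simp_all
  also have "(\<integral>\<^sup>+z. ennreal (dist (fst z) (\<pi> (fst z))) \<partial>\<gamma>) = (\<integral>\<^sup>+x. ennreal (dist x (\<pi> x)) \<partial>\<mu>)"
    using fst_int[of "\<lambda>x. ennreal (dist x (\<pi> x))"] by simp
  also have "(\<integral>\<^sup>+z. ennreal (dist (snd z) (\<pi> (snd z))) \<partial>\<gamma>) = (\<integral>\<^sup>+x. ennreal (dist x (\<pi> x)) \<partial>\<nu>)"
    using snd_int[of "\<lambda>x. ennreal (dist x (\<pi> x))"] by simp
  also have "(\<integral>\<^sup>+z. ennreal (dist (\<pi> (fst z)) (\<pi> (snd z))) \<partial>\<gamma>) = ennreal (transport_cost Z w)"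
  proof -
    let ?g = "\<lambda>u v. ennreal (h u v) * ennreal (dist u v)"
    have "(\<integral>\<^sup>+z. ennreal (dist (\<pi> (fst z)) (\<pi> (snd z))) \<partial>\<gamma>)
      = (\<integral>\<^sup>+z. ?g (\<pi> (fst z)) (\<pi> (snd z)) \<partial>(\<mu> \<Otimes>\<^sub>M \<nu>))"
      unfolding \<gamma>_def by (subst nn_integral_density) auto
    also have "\<dots> = (\<integral>\<^sup>+x. \<integral>\<^sup>+y. ?g (\<pi> x) (\<pi> y) \<partial>\<nu> \<partial>\<mu>)"
      by (subst \<nu>.nn_integral_fst[symmetric]) auto
    also have "\<dots> = (\<integral>\<^sup>+x. (\<Sum>v\<in>Z. ?g (\<pi> x) v * ennreal (b v)) \<partial>\<mu>)"
      by (subst nn_integral_fibres[OF fin \<pi>Z simp(2)]) (simp add: b_def \<nu>.emeasure_eq_measure)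
    also have "\<dots> = (\<Sum>u\<in>Z. (\<Sum>v\<in>Z. ?g u v * ennreal (b v)) * ennreal (a u))"
      by (subst nn_integral_fibres[OF fin \<pi>Z simp(1), of "\<lambda>u. \<Sum>v\<in>Z. ?g u v * ennreal (b v)"])
        (simp add: a_def \<mu>.emeasure_eq_measure)
    also have "\<dots> = (\<Sum>u\<in>Z. (\<Sum>v\<in>Z. ennreal (w u v * dist u v)))"
      unfolding sum_distrib_right
    proof (intro sum.cong refl)
      fix u v assume uv: "u \<in> Z" "v \<in> Z"
      have "?g u v * ennreal (b v) * ennreal (a u) = ennreal (h u v * dist u v * b v * a u)"
        using h0[OF uv] by (simp add: ennreal_mult a_def b_def)
      also have "h u v * dist u v * b v * a u = w u v * dist u v"
        using transport_plan_eq_0[OF plan' fin uv] by (cases "a u = 0 \<or> b v = 0") (auto simp: h_def)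
      finally show "?g u v * ennreal (b v) * ennreal (a u) = ennreal (w u v * dist u v)" .
    qed
    also have "\<dots> = ennreal (transport_cost Z w)"
      unfolding transport_cost_def using transport_plan_nonneg[OF plan']
      by (simp add: sum_nonneg)
    finally show ?thesis .
  qed
  finally show ?thesis .
qed

subsection \<open>Empirical measures\<close>

lemma prob_space_empirical_measure:
  assumes "0 < n"
  shows "prob_space (empirical_measure n x)"
proof -
  interpret prob_space "uniform_count_measure {..<n}"
    using assms by (intro prob_space_uniform_count_measure) auto
  show ?thesis
    unfolding empirical_measure_def
    by (rule prob_space_distr) (simp add: uniform_count_measure_def)
qed

lemma sets_empirical_measure: "sets (empirical_measure n x) = sets borel"
  by (simp add: empirical_measure_def)

lemma nn_integral_empirical_measure:
  assumes "0 < n" and [measurable]: "f \<in> borel_measurable borel"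
  shows "(\<integral>\<^sup>+y. f y \<partial>empirical_measure n x) = (\<Sum>i<n. f (x i)) / of_nat n"
proof -
  have "(\<integral>\<^sup>+y. f y \<partial>empirical_measure n x) = (\<integral>\<^sup>+i. f (x i) \<partial>uniform_count_measure {..<n})"
    unfolding empirical_measure_def
    by (subst nn_integral_distr) (auto simp: uniform_count_measure_def)
  also have "\<dots> = (\<Sum>i<n. ennreal (1 / real n) * f (x i))"
    by (simp add: uniform_count_measure_def nn_integral_point_measure_finite)
  also have "\<dots> = (\<Sum>i<n. f (x i)) / of_nat n"
    using assms(1) unfolding sum_distrib_left[symmetric] by (simp add: divide_ennreal_def
        inverse_ennreal ennreal_of_nat_eq_real_of_nat inverse_eq_divide mult.commute)
  finally show ?thesis .
qed

section \<open>Expectations under i.i.d. sampling\<close>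

lemma iid_samples_measurable:
  assumes "iid_samples M n X P" "i < n"
  shows "X i \<in> borel_measurable M"
  using assms unfolding iid_samples_def
  by (auto simp: prob_space.indep_vars_def)

lemma iid_samples_nn_integral:
  assumes "iid_samples M n X P" "i < n" "f \<in> borel_measurable borel"
  shows "(\<integral>\<^sup>+\<omega>. f (X i \<omega>) \<partial>M) = (\<integral>\<^sup>+x. f x \<partial>P)"
proof -
  have "(\<integral>\<^sup>+x. f x \<partial>distr M borel (X i)) = (\<integral>\<^sup>+\<omega>. f (X i \<omega>) \<partial>M)"
    using iid_samples_measurable[OF assms(1,2)] assms(3) by (simp add: nn_integral_distr)
  then show ?thesis using assms(1,2) by (simp add: iid_samples_def)
qed

lemma iid_samples_measure:
  assumes "iid_samples M n X P" "i < n" "A \<in> sets borel"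
  shows "measure M {\<omega> \<in> space M. X i \<omega> \<in> A} = measure P A"
proof -
  have "measure (distr M borel (X i)) A = measure M (X i -` A \<inter> space M)"
    using iid_samples_measurable[OF assms(1,2)] assms(3) by (rule measure_distr)
  then show ?thesis using assms(1,2) by (simp add: iid_samples_def vimage_def Int_def conj_commute)
qed

text \<open>Every sample has law \<open>P\<close>, so by linearity the empirical measure has mean
  \<open>P\<close>. The expected projection error of the empirical measure thus equals that of
  \<open>P\<close>, whence the factor 2 in the chaining bound.\<close>

lemma nn_integral_expected_empirical_measure:
  assumes iid: "iid_samples M n X P" and "0 < n" and f[measurable]: "f \<in> borel_measurable borel"
  shows "(\<integral>\<^sup>+\<omega>. (\<integral>\<^sup>+y. f y \<partial>empirical_measure n (\<lambda>i. X i \<omega>)) \<partial>M) = (\<integral>\<^sup>+x. f x \<partial>P)"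
proof -
  have [measurable]: "(\<lambda>\<omega>. f (X i \<omega>)) \<in> borel_measurable M" if "i < n" for i
    using iid_samples_measurable[OF iid that] by measurable
  have "(\<integral>\<^sup>+\<omega>. (\<integral>\<^sup>+y. f y \<partial>empirical_measure n (\<lambda>i. X i \<omega>)) \<partial>M)
    = (\<integral>\<^sup>+\<omega>. (\<Sum>i<n. f (X i \<omega>)) / of_nat n \<partial>M)"
    using assms(2) by (simp add: nn_integral_empirical_measure)
  also have "\<dots> = (\<integral>\<^sup>+\<omega>. (\<Sum>i<n. f (X i \<omega>)) \<partial>M) / of_nat n"
    by (intro nn_integral_divide borel_measurable_sum) auto
  also have "\<dots> = (\<Sum>i<n. \<integral>\<^sup>+\<omega>. f (X i \<omega>) \<partial>M) / of_nat n"
    by (subst nn_integral_sum) auto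
  also have "\<dots> = (of_nat n * (\<integral>\<^sup>+x. f x \<partial>P)) / of_nat n"
    using iid_samples_nn_integral[OF iid _ f] by simp
  also have "\<dots> = (\<integral>\<^sup>+x. f x \<partial>P)"
    using assms(2) by (subst mult.commute, intro mult_divide_eq_ennreal) (auto simp: ennreal_of_nat_neq_top)
  finally show ?thesis .
qed

lemma measure_empirical_measure_eq_sum:
  assumes "A \<in> sets borel"
  shows "measure (empirical_measure n x) A = (\<Sum>i<n. indicator A (x i)) / real n"
proof -
  have "(\<Sum>i<n. indicator A (x i)) = real (card {i. i < n \<and> x i \<in> A})"
    by (simp add: indicator_def of_bool_def sum.If_cases Int_def)
  then show ?thesis using assms by (simp add: measure_empirical_measure)
qed

text \<open>The deviation is an average of independent centred variables: off-diagonal products have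
  mean zero, diagonal ones the variance \<open>p - p^2\<close>. Keeping the factor \<open>p\<close>,
  instead of a uniform bound, lets the sum over cells become an integral against \<open>P\<close>
  later.\<close>

lemma empirical_measure_mean_square:
  assumes iid: "iid_samples M n X P" and "0 < n" and A[measurable]: "A \<in> sets borel"
  shows "(\<integral>\<^sup>+\<omega>. ennreal ((measure (empirical_measure n (\<lambda>i. X i \<omega>)) A - measure P A)\<^sup>2) \<partial>M)
    \<le> ennreal (measure P A / real n)"
proof -
  interpret prob_space M using iid by (simp add: iid_samples_def)
  define p where "p = measure P A"
  define Y where "Y i \<omega> = indicator A (X i \<omega>) - p" for i \<omega>
  have Xm[measurable]: "X i \<in> borel_measurable M" if "i < n" for i
    using iid_samples_measurable[OF iid that] .
  have Ym[measurable]: "Y i \<in> borel_measurable M" if "i < n" for i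
    unfolding Y_def using that by measurable
  have pX: "expectation (\<lambda>\<omega>. indicator A (X i \<omega>)) = p" if "i < n" for i
  proof -
    have "expectation (\<lambda>\<omega>. indicator A (X i \<omega>)) = expectation (indicator {\<omega> \<in> space M. X i \<omega> \<in> A})"
      by (intro Bochner_Integration.integral_cong) (auto simp: indicator_def)
    also have "\<dots> = p"
      using iid_samples_measure[OF iid that A] that by (simp add: p_def)
    finally show ?thesis .
  qed
  have iX: "integrable M (\<lambda>\<omega>. indicator A (X i \<omega>) :: real)" if "i < n" for i
    using that by (intro integrable_const_bound[where B=1]) (auto simp: indicator_def)
  have p01: "0 \<le> p" "p \<le> 1"
    using iid_samples_measure[OF iid \<open>0 < n\<close> A] prob_le_1[of "{\<omega> \<in> space M. X 0 \<omega> \<in> A}"]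
    by (auto simp: p_def)
  have bdd: "\<bar>Y i \<omega>\<bar> \<le> 1" for i \<omega>
    using p01 by (auto simp: Y_def indicator_def)
  have bdd2: "\<bar>Y i \<omega> * Y j \<omega>\<bar> \<le> 1" for i j \<omega>
    using mult_mono[OF bdd bdd, of i \<omega> j \<omega>] by (simp add: abs_mult mult.commute)
  have int: "integrable M (Y i)" if "i < n" for i
    using that bdd by (intro integrable_const_bound[where B=1]) auto
  have int2: "integrable M (\<lambda>\<omega>. Y i \<omega> * Y j \<omega>)" if "i < n" "j < n" for i j
    using that bdd2 by (intro integrable_const_bound[where B=1]) auto
  have EY: "expectation (Y i) = 0" if "i < n" for i
    using that iX pX unfolding Y_def by (simp add: prob_space)
  have EYY: "expectation (\<lambda>\<omega>. Y i \<omega> * Y i \<omega>) \<le> p" if "i < n" for i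
  proof -
    \<comment> \<open>An indicator equals its square, so the square of \<open>Y i\<close> is affine
      in the indicator.\<close>
    have "expectation (\<lambda>\<omega>. Y i \<omega> * Y i \<omega>) = expectation (\<lambda>\<omega>. (1 - 2 * p) * indicator A (X i \<omega>) + p\<^sup>2)"
      by (intro Bochner_Integration.integral_cong)
        (auto simp: Y_def indicator_def algebra_simps power2_eq_square)
    also have "\<dots> = (1 - 2 * p) * p + p\<^sup>2"
      using that iX pX by (simp add: prob_space)
    also have "\<dots> \<le> p" by (simp add: algebra_simps power2_eq_square)
    finally show ?thesis .
  qed
  have indY: "indep_vars (\<lambda>_. borel) Y {..<n}"
  proof -
    have "indep_vars (\<lambda>_. borel) X {..<n}" using iid by (simp add: iid_samples_def)
    from indep_vars_compose2[OF this, of "\<lambda>_ x. indicator A x - p" "\<lambda>_. borel"]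
    show ?thesis unfolding Y_def by simp
  qed
  have cov: "expectation (\<lambda>\<omega>. Y i \<omega> * Y j \<omega>) = 0" if "i < n" "j < n" "i \<noteq> j" for i j
  proof -
    have "indep_vars (\<lambda>_. borel) Y {i, j}" using that by (intro indep_vars_subset[OF indY]) auto
    from indep_vars_lebesgue_integral[OF _ this] int that
    have "expectation (\<lambda>\<omega>. \<Prod>k\<in>{i, j}. Y k \<omega>) = (\<Prod>k\<in>{i, j}. expectation (Y k))" by auto
    then show ?thesis using that EY by simp
  qed
  have E2: "expectation (\<lambda>\<omega>. \<Sum>i<n. \<Sum>j<n. Y i \<omega> * Y j \<omega>)
    = (\<Sum>i<n. \<Sum>j<n. expectation (\<lambda>\<omega>. Y i \<omega> * Y j \<omega>))"
  proof -
    have "expectation (\<lambda>\<omega>. \<Sum>i<n. \<Sum>j<n. Y i \<omega> * Y j \<omega>)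
      = (\<Sum>i<n. expectation (\<lambda>\<omega>. \<Sum>j<n. Y i \<omega> * Y j \<omega>))"
      by (rule Bochner_Integration.integral_sum) (auto intro!: Bochner_Integration.integrable_sum int2)
    also have "\<dots> = (\<Sum>i<n. \<Sum>j<n. expectation (\<lambda>\<omega>. Y i \<omega> * Y j \<omega>))"
      by (intro sum.cong refl Bochner_Integration.integral_sum) (auto intro!: int2)
    finally show ?thesis .
  qed
  have "(\<integral>\<^sup>+\<omega>. ennreal ((measure (empirical_measure n (\<lambda>i. X i \<omega>)) A - measure P A)\<^sup>2) \<partial>M)
    = (\<integral>\<^sup>+\<omega>. ennreal ((\<Sum>i<n. \<Sum>j<n. Y i \<omega> * Y j \<omega>) / (real n)\<^sup>2) \<partial>M)"
  proof (intro nn_integral_cong arg_cong[where f=ennreal])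
    fix \<omega>
    have "measure (empirical_measure n (\<lambda>i. X i \<omega>)) A - measure P A = (\<Sum>i<n. Y i \<omega>) / real n"
      using \<open>0 < n\<close> by (simp add: measure_empirical_measure_eq_sum[OF A] Y_def sum_subtractf
          p_def diff_divide_distrib)
    then show "(measure (empirical_measure n (\<lambda>i. X i \<omega>)) A - measure P A)\<^sup>2
      = (\<Sum>i<n. \<Sum>j<n. Y i \<omega> * Y j \<omega>) / (real n)\<^sup>2"
      by (simp add: power_divide power2_eq_square sum_product)
  qed
  also have "\<dots> = ennreal (expectation (\<lambda>\<omega>. (\<Sum>i<n. \<Sum>j<n. Y i \<omega> * Y j \<omega>) / (real n)\<^sup>2))"
  proof (intro nn_integral_eq_integral AE_I2)
    fix \<omega>
    show "0 \<le> (\<Sum>i<n. \<Sum>j<n. Y i \<omega> * Y j \<omega>) / (real n)\<^sup>2"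
      unfolding sum_product[symmetric] by (simp add: power2_eq_square[symmetric])
  qed (use int2 in \<open>auto intro!: integrable_divide Bochner_Integration.integrable_sum\<close>)
  also have "expectation (\<lambda>\<omega>. (\<Sum>i<n. \<Sum>j<n. Y i \<omega> * Y j \<omega>) / (real n)\<^sup>2)
    = (\<Sum>i<n. \<Sum>j<n. expectation (\<lambda>\<omega>. Y i \<omega> * Y j \<omega>)) / (real n)\<^sup>2"
    by (simp add: E2)
  also have "(\<Sum>i<n. \<Sum>j<n. expectation (\<lambda>\<omega>. Y i \<omega> * Y j \<omega>))
    = (\<Sum>i<n. expectation (\<lambda>\<omega>. Y i \<omega> * Y i \<omega>))"
  proof (intro sum.cong refl)
    fix i assume "i \<in> {..<n}"
    then show "(\<Sum>j<n. expectation (\<lambda>\<omega>. Y i \<omega> * Y j \<omega>)) = expectation (\<lambda>\<omega>. Y i \<omega> * Y i \<omega>)"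
      using cov by (subst sum.remove[of _ i]) (auto intro!: sum.neutral)
  qed
  also have "ennreal ((\<Sum>i<n. expectation (\<lambda>\<omega>. Y i \<omega> * Y i \<omega>)) / (real n)\<^sup>2) \<le> ennreal (p / real n)"
  proof (rule ennreal_leI)
    have "(\<Sum>i<n. expectation (\<lambda>\<omega>. Y i \<omega> * Y i \<omega>)) \<le> real n * p"
      using sum_mono[of "{..<n}" "\<lambda>i. expectation (\<lambda>\<omega>. Y i \<omega> * Y i \<omega>)" "\<lambda>_. p"] EYY by simp
    then show "(\<Sum>i<n. expectation (\<lambda>\<omega>. Y i \<omega> * Y i \<omega>)) / (real n)\<^sup>2 \<le> p / real n"
      using \<open>0 < n\<close> by (simp add: divide_simps power2_eq_square mult.commute)
  qed
  finally show ?thesis by (simp add: p_def)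
qed

subsection \<open>Chains of projections\<close>

text \<open>The composition of \<open>\<rho> k\<close> to \<open>\<rho> K\<close> with the finest
  projection acting first, so that level \<open>k\<close> is a function of level
  \<open>Suc k\<close>. At \<open>k = Suc K\<close> it is the identity, the base of the downward
  inductions.\<close>

definition chain :: "(nat \<Rightarrow> 'a \<Rightarrow> 'a) \<Rightarrow> nat \<Rightarrow> nat \<Rightarrow> 'a \<Rightarrow> 'a" where
  "chain \<rho> K k = foldr \<rho> [k..<Suc K]"

lemma chain_rec: "k \<le> K \<Longrightarrow> chain \<rho> K k x = \<rho> k (chain \<rho> K (Suc k) x)"
  unfolding chain_def by (subst upt_conv_Cons) auto

lemma chain_beyond: "chain \<rho> K (Suc K) x = x"
  by (simp add: chain_def)

lemma chain_top: "chain \<rho> K K x = \<rho> K x"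
  by (simp add: chain_rec chain_beyond)

lemma chain_measurable:
  fixes \<rho> :: "nat \<Rightarrow> 'a::topological_space \<Rightarrow> 'a"
  assumes "\<And>i. \<rho> i \<in> borel_measurable borel" "k \<le> Suc K"
  shows "chain \<rho> K k \<in> borel_measurable borel"
  using assms(2)
proof (induction rule: inc_induct)
  case base
  then show ?case by (simp add: chain_beyond[abs_def])
next
  case (step k)
  then have "chain \<rho> K k = (\<lambda>x. \<rho> k (chain \<rho> K (Suc k) x))" by (auto simp: chain_rec)
  with step.IH assms(1)[of k] show ?case by simp
qed

lemma chain_range: "(\<And>i. range (\<rho> i) \<subseteq> Z i) \<Longrightarrow> k \<le> K \<Longrightarrow> range (chain \<rho> K k) \<subseteq> Z k"
  by (force simp: chain_rec)

text \<open>Additivity over the finitely many cells that \<open>\<rho>\<close> merges; it yields the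
  conservation law of the net flow at a tree node.\<close>

lemma measure_fibre_image:
  fixes \<mu> :: "'a::topological_space measure" and \<pi> :: "'a \<Rightarrow> 'b::t1_space"
  assumes "finite_measure \<mu>" "sets \<mu> = sets borel" "\<pi> \<in> borel_measurable borel"
    "range \<pi> \<subseteq> A" "finite A"
  shows "measure \<mu> {x. \<rho> (\<pi> x) = u} = (\<Sum>z | z \<in> A \<and> \<rho> z = u. measure \<mu> {x. \<pi> x = z})"
proof -
  interpret finite_measure \<mu> by fact
  have meas: "{x. \<pi> x = z} \<in> sets borel" for z
    using measurable_sets_borel[OF assms(3) borel_closed[OF closed_singleton, of z]] by (simp add: vimage_def)
  have "{x. \<rho> (\<pi> x) = u} = (\<Union>z\<in>{z \<in> A. \<rho> z = u}. {x. \<pi> x = z})"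
    using assms(4) by auto
  then show ?thesis
    using assms meas by (auto simp: disjoint_family_on_def intro!: finite_measure_finite_Union)
qed

lemma wasserstein1_chain_bound:
  fixes \<mu> \<nu> :: "'a::{real_normed_vector, second_countable_topology} measure"
  assumes \<mu>: "prob_space \<mu>" "sets \<mu> = sets borel" and \<nu>: "prob_space \<nu>" "sets \<nu> = sets borel"
    and \<rho>: "\<And>i. \<rho> i \<in> borel_measurable borel" "\<And>i. range (\<rho> i) \<subseteq> Z i"
    and Z: "\<And>i. finite (Z i)" "Z 0 = {c}"
  shows "wasserstein1 \<mu> \<nu> \<le> (\<integral>\<^sup>+x. ennreal (dist x (\<rho> K x)) \<partial>\<mu>) + (\<integral>\<^sup>+x. ennreal (dist x (\<rho> K x)) \<partial>\<nu>)
    + ennreal (\<Sum>i<K. \<Sum>z\<in>Z (Suc i). dist z (\<rho> i z) *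
        \<bar>measure \<mu> {x. chain \<rho> K (Suc i) x = z} - measure \<nu> {x. chain \<rho> K (Suc i) x = z}\<bar>)"
proof -
  interpret \<mu>: prob_space \<mu> by fact
  interpret \<nu>: prob_space \<nu> by fact
  have [simp]: "space \<mu> = UNIV" "space \<nu> = UNIV"
    using sets_eq_imp_space_eq[OF \<mu>(2)] sets_eq_imp_space_eq[OF \<nu>(2)] by auto
  define D where "D i z = measure \<mu> {x. chain \<rho> K i x = z} - measure \<nu> {x. chain \<rho> K i x = z}" for i z
  have "\<exists>w. transport_plan (Z K) (\<lambda>z. measure \<mu> {x. \<rho> K x = z}) (\<lambda>z. measure \<nu> {x. \<rho> K x = z}) w \<and>
    transport_cost (Z K) w \<le> (\<Sum>i<K. \<Sum>z\<in>Z (Suc i). dist z (\<rho> i z) * \<bar>D (Suc i) z\<bar>)"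
  proof (rule tree_transport)
    show "D 0 c = 0"
    proof -
      \<comment> \<open>The root cell is the whole space, where two probability measures
        agree.\<close>
      have "chain \<rho> K 0 x = c" for x using chain_range[of \<rho> Z 0 K] \<rho>(2) Z(2) by auto
      then show ?thesis using \<mu>.prob_space \<nu>.prob_space by (simp add: D_def)
    qed
    show "D i u = (\<Sum>z | z \<in> Z (Suc i) \<and> \<rho> i z = u. D (Suc i) z)" if "i < K" for i u
      using measure_fibre_image[OF \<mu>.finite_measure_axioms \<mu>(2), of "chain \<rho> K (Suc i)" "Z (Suc i)" "\<rho> i" u]
        measure_fibre_image[OF \<nu>.finite_measure_axioms \<nu>(2), of "chain \<rho> K (Suc i)" "Z (Suc i)" "\<rho> i" u]
        chain_measurable[of \<rho> "Suc i" K] chain_range[of \<rho> Z "Suc i" K] \<rho> Z that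
      by (simp add: D_def chain_rec sum_subtractf)
    show "\<rho> i ` Z (Suc i) \<subseteq> Z i" for i using \<rho>(2)[of i] by auto
  qed (use Z in \<open>auto simp: D_def chain_top\<close>)
  then obtain w where w: "transport_plan (Z K) (\<lambda>z. measure \<mu> {x. \<rho> K x = z}) (\<lambda>z. measure \<nu> {x. \<rho> K x = z}) w"
    and cost: "transport_cost (Z K) w \<le> (\<Sum>i<K. \<Sum>z\<in>Z (Suc i). dist z (\<rho> i z) * \<bar>D (Suc i) z\<bar>)"
    by blast
  have "wasserstein1 \<mu> \<nu> \<le> (\<integral>\<^sup>+x. ennreal (dist x (\<rho> K x)) \<partial>\<mu>) + (\<integral>\<^sup>+x. ennreal (dist x (\<rho> K x)) \<partial>\<nu>)
    + ennreal (transport_cost (Z K) w)"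
    by (rule wasserstein1_le_transport_cost[OF \<mu> \<nu> \<rho> Z(1) w])
  also have "\<dots> \<le> (\<integral>\<^sup>+x. ennreal (dist x (\<rho> K x)) \<partial>\<mu>) + (\<integral>\<^sup>+x. ennreal (dist x (\<rho> K x)) \<partial>\<nu>)
    + ennreal (\<Sum>i<K. \<Sum>z\<in>Z (Suc i). dist z (\<rho> i z) * \<bar>D (Suc i) z\<bar>)"
    using cost by (intro add_left_mono ennreal_leI)
  finally show ?thesis by (simp add: D_def)
qed

text \<open>Cauchy--Schwarz before optimising the weight. The constant term does not involve
  \<open>a\<close> or \<open>b\<close>; summed over the cells of a level it becomes their
  number.\<close>

lemma mult_le_weighted_squares:
  fixes a b \<theta> :: real
  assumes "0 < \<theta>"
  shows "a * b \<le> (\<theta> * a\<^sup>2 * b\<^sup>2 + 1 / \<theta>) / 2"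
proof -
  have "0 \<le> (\<theta> * (a * b) - 1)\<^sup>2 / \<theta>" using assms by simp
  also have "\<dots> = \<theta> * a\<^sup>2 * b\<^sup>2 + 1 / \<theta> - 2 * (a * b)"
    using assms by (simp add: power2_eq_square field_simps)
  finally show ?thesis by simp
qed

text \<open>On each edge the product of length and deviation is replaced by weighted squares. The
  squared parts sum to \<open>\<theta> i\<close> times the mean square of the projection step, the
  constant parts to the number of cells over \<open>n * \<theta> i\<close>. The weights stay free
  until the sizes of both are known.\<close>

lemma expected_wasserstein1_chain_bound:
  fixes P :: "'a::{real_normed_vector, second_countable_topology} measure"
  assumes P: "prob_space P" "sets P = sets borel"
    and iid: "iid_samples M n X P" and n: "0 < n"
    and \<rho>: "\<And>i. \<rho> i \<in> borel_measurable borel" "\<And>i. range (\<rho> i) \<subseteq> Z i"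
    and Z: "\<And>i. finite (Z i)" "Z 0 = {c}"
    and \<theta>: "\<And>i. i < K \<Longrightarrow> 0 < \<theta> i"
    and V: "\<And>i. i < K \<Longrightarrow> 0 \<le> V i"
      "\<And>i. i < K \<Longrightarrow> (\<integral>\<^sup>+x. ennreal ((dist (chain \<rho> K (Suc i) x) (chain \<rho> K i x))\<^sup>2) \<partial>P) \<le> ennreal (V i)"
  shows "(\<integral>\<^sup>+\<omega>. wasserstein1 (empirical_measure n (\<lambda>i. X i \<omega>)) P \<partial>M)
    \<le> 2 * (\<integral>\<^sup>+x. ennreal (dist x (\<rho> K x)) \<partial>P)
      + ennreal (\<Sum>i<K. (\<theta> i * V i + real (card (Z (Suc i))) / (real n * \<theta> i)) / 2)"
proof -
  interpret M: prob_space M using iid by (simp add: iid_samples_def)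
  interpret P: prob_space P by fact
  have [simp]: "space P = UNIV" using sets_eq_imp_space_eq[OF P(2)] by auto
  note [measurable] = \<rho>(1)
  have Xm[measurable]: "X i \<in> borel_measurable M" if "i < n" for i
    using iid_samples_measurable[OF iid that] .
  define E where "E \<omega> = empirical_measure n (\<lambda>i. X i \<omega>)" for \<omega>
  define F where "F i z = {x. chain \<rho> K (Suc i) x = z}" for i z
  have F[measurable]: "F i z \<in> sets borel" if "i < K" for i z
    using measurable_sets_borel[OF chain_measurable[OF \<rho>(1), where k="Suc i" and K=K], of "{z}"] that
    by (simp add: F_def vimage_def)
  define \<Delta> where "\<Delta> i z \<omega> = measure (E \<omega>) (F i z) - measure P (F i z)" for i z \<omega>
  have \<Delta>[measurable]: "\<Delta> i z \<in> borel_measurable M" if "i < K" for i z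
    unfolding \<Delta>_def E_def measure_empirical_measure_eq_sum[OF F[OF that]] using F[OF that] by measurable
  define R where "R = (\<integral>\<^sup>+x. ennreal (dist x (\<rho> K x)) \<partial>P)"
  \<comment> \<open>The two parts of the weighted inequality with weight
    \<open>n * \<theta> i\<close>; the factor \<open>n\<close> cancels the \<open>1 / n\<close> of
    the mean square deviation.\<close>
  define b where "b i = ennreal (1 / (2 * real n * \<theta> i))" for i
  define a where "a i z = ennreal (real n * \<theta> i * (dist z (\<rho> i z))\<^sup>2 / 2)" for i z
  have W: "wasserstein1 (E \<omega>) P \<le> (\<integral>\<^sup>+x. ennreal (dist x (\<rho> K x)) \<partial>E \<omega>) + R
    + (\<Sum>i<K. \<Sum>z\<in>Z (Suc i). a i z * ennreal ((\<Delta> i z \<omega>)\<^sup>2) + b i)" for \<omega>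
  proof -
    have "wasserstein1 (E \<omega>) P \<le> (\<integral>\<^sup>+x. ennreal (dist x (\<rho> K x)) \<partial>E \<omega>) + R
      + ennreal (\<Sum>i<K. \<Sum>z\<in>Z (Suc i). dist z (\<rho> i z) * \<bar>\<Delta> i z \<omega>\<bar>)"
      unfolding R_def \<Delta>_def F_def
      by (rule wasserstein1_chain_bound[where \<rho>=\<rho> and Z=Z and c=c])
        (use prob_space_empirical_measure[OF n] P \<rho> Z in \<open>auto simp: E_def sets_empirical_measure\<close>)
    also have "ennreal (\<Sum>i<K. \<Sum>z\<in>Z (Suc i). dist z (\<rho> i z) * \<bar>\<Delta> i z \<omega>\<bar>)
      = (\<Sum>i<K. \<Sum>z\<in>Z (Suc i). ennreal (dist z (\<rho> i z) * \<bar>\<Delta> i z \<omega>\<bar>))"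
      by (simp add: sum_nonneg)
    also have "\<dots> \<le> (\<Sum>i<K. \<Sum>z\<in>Z (Suc i). a i z * ennreal ((\<Delta> i z \<omega>)\<^sup>2) + b i)"
    proof (intro sum_mono)
      fix i z assume "i \<in> {..<K}"
      then have \<theta>n: "0 < real n * \<theta> i" using \<theta> n by simp
      have "dist z (\<rho> i z) * \<bar>\<Delta> i z \<omega>\<bar>
        \<le> real n * \<theta> i * (dist z (\<rho> i z))\<^sup>2 / 2 * (\<Delta> i z \<omega>)\<^sup>2 + 1 / (2 * real n * \<theta> i)"
        using mult_le_weighted_squares[OF \<theta>n, of "dist z (\<rho> i z)" "\<bar>\<Delta> i z \<omega>\<bar>"]
        by (simp add: field_simps)
      then show "ennreal (dist z (\<rho> i z) * \<bar>\<Delta> i z \<omega>\<bar>) \<le> a i z * ennreal ((\<Delta> i z \<omega>)\<^sup>2) + b i"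
        using \<theta>n by (simp add: a_def b_def ennreal_mult[symmetric] ennreal_plus[symmetric] ennreal_leI
            del: ennreal_plus)
    qed
    finally show ?thesis by (simp add: add_left_mono)
  qed
  \<comment> \<open>The pointwise bound goes in before the integral is split: its terms are
    measurable in \<open>\<omega>\<close>, and monotonicity asks no measurability of
    \<open>wasserstein1\<close>.\<close>
  have "(\<integral>\<^sup>+\<omega>. wasserstein1 (E \<omega>) P \<partial>M) \<le> (\<integral>\<^sup>+\<omega>. (\<integral>\<^sup>+x. ennreal (dist x (\<rho> K x)) \<partial>E \<omega>) + R
    + (\<Sum>i<K. \<Sum>z\<in>Z (Suc i). a i z * ennreal ((\<Delta> i z \<omega>)\<^sup>2) + b i) \<partial>M)"
    using W by (intro nn_integral_mono)
  also have "\<dots> = (\<integral>\<^sup>+\<omega>. (\<integral>\<^sup>+x. ennreal (dist x (\<rho> K x)) \<partial>E \<omega>) \<partial>M) + R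
    + (\<Sum>i<K. \<Sum>z\<in>Z (Suc i). a i z * (\<integral>\<^sup>+\<omega>. ennreal ((\<Delta> i z \<omega>)\<^sup>2) \<partial>M) + b i)"
  proof -
    have m1: "(\<lambda>\<omega>. \<integral>\<^sup>+x. ennreal (dist x (\<rho> K x)) \<partial>E \<omega>) \<in> borel_measurable M"
      unfolding E_def using n by (simp add: nn_integral_empirical_measure) measurable
    have m2: "(\<lambda>\<omega>. \<Sum>i<K. \<Sum>z\<in>Z (Suc i). a i z * ennreal ((\<Delta> i z \<omega>)\<^sup>2) + b i) \<in> borel_measurable M"
      using \<Delta> by measurable
    have "(\<integral>\<^sup>+\<omega>. (\<Sum>i<K. \<Sum>z\<in>Z (Suc i). a i z * ennreal ((\<Delta> i z \<omega>)\<^sup>2) + b i) \<partial>M)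
      = (\<Sum>i<K. \<integral>\<^sup>+\<omega>. (\<Sum>z\<in>Z (Suc i). a i z * ennreal ((\<Delta> i z \<omega>)\<^sup>2) + b i) \<partial>M)"
      using \<Delta> by (intro nn_integral_sum) measurable
    also have "\<dots> = (\<Sum>i<K. \<Sum>z\<in>Z (Suc i). a i z * (\<integral>\<^sup>+\<omega>. ennreal ((\<Delta> i z \<omega>)\<^sup>2) \<partial>M) + b i)"
    proof (intro sum.cong refl)
      fix i assume "i \<in> {..<K}"
      then have [measurable]: "\<Delta> i z \<in> borel_measurable M" for z using \<Delta> by simp
      show "(\<integral>\<^sup>+\<omega>. (\<Sum>z\<in>Z (Suc i). a i z * ennreal ((\<Delta> i z \<omega>)\<^sup>2) + b i) \<partial>M)
        = (\<Sum>z\<in>Z (Suc i). a i z * (\<integral>\<^sup>+\<omega>. ennreal ((\<Delta> i z \<omega>)\<^sup>2) \<partial>M) + b i)"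
        by (subst nn_integral_sum, measurable)
          (simp add: nn_integral_add nn_integral_cmult M.emeasure_space_1)
    qed
    finally show ?thesis
      using m1 m2 by (simp add: nn_integral_add M.emeasure_space_1)
  qed
  also have "(\<integral>\<^sup>+\<omega>. (\<integral>\<^sup>+x. ennreal (dist x (\<rho> K x)) \<partial>E \<omega>) \<partial>M) = R"
    unfolding E_def R_def by (rule nn_integral_expected_empirical_measure[OF iid n]) measurable
  also have "(\<Sum>i<K. \<Sum>z\<in>Z (Suc i). a i z * (\<integral>\<^sup>+\<omega>. ennreal ((\<Delta> i z \<omega>)\<^sup>2) \<partial>M) + b i)
    \<le> (\<Sum>i<K. ennreal ((\<theta> i * V i + real (card (Z (Suc i))) / (real n * \<theta> i)) / 2))"
  proof (intro sum_mono)
    fix i assume "i \<in> {..<K}"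
    then have i: "i < K" by simp
    have \<theta>i: "0 < \<theta> i" using \<theta> i by simp
    have sf: "simple_function P (chain \<rho> K (Suc i))"
    proof (rule simple_function_borel_measurable)
      show "chain \<rho> K (Suc i) \<in> borel_measurable P"
        using chain_measurable[OF \<rho>(1), where k="Suc i" and K=K] i
        by (simp add: measurable_cong_sets[OF P(2) refl])
      show "finite (chain \<rho> K (Suc i) ` space P)"
        using finite_subset[OF chain_range[of \<rho> Z "Suc i" K] Z(1)] \<rho>(2) i by simp
    qed
    have "(\<Sum>z\<in>Z (Suc i). a i z * (\<integral>\<^sup>+\<omega>. ennreal ((\<Delta> i z \<omega>)\<^sup>2) \<partial>M))
      \<le> (\<Sum>z\<in>Z (Suc i). a i z * ennreal (measure P (F i z) / real n))"
      unfolding \<Delta>_def E_def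
      by (intro sum_mono mult_left_mono empirical_measure_mean_square[OF iid n] F i) auto
    also have "\<dots> = (\<Sum>z\<in>Z (Suc i). ennreal (\<theta> i / 2) *
        (ennreal ((dist z (\<rho> i z))\<^sup>2) * emeasure P {x \<in> space P. chain \<rho> K (Suc i) x = z}))"
    proof (intro sum.cong refl)
      fix z
      show "a i z * ennreal (measure P (F i z) / real n) = ennreal (\<theta> i / 2) *
        (ennreal ((dist z (\<rho> i z))\<^sup>2) * emeasure P {x \<in> space P. chain \<rho> K (Suc i) x = z})"
        using \<theta>i n by (simp add: a_def P.emeasure_eq_measure F_def ennreal_mult[symmetric] mult_ac)
    qed
    \<comment> \<open>On the cell of \<open>z\<close> the step is constantly
      \<open>dist z (\<rho> i z)\<close>, so the sum weighted by cell masses is an integral.\<close>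
    also have "\<dots> = ennreal (\<theta> i / 2) * (\<integral>\<^sup>+x. ennreal ((dist (chain \<rho> K (Suc i) x) (chain \<rho> K i x))\<^sup>2) \<partial>P)"
    proof -
      have "(\<integral>\<^sup>+x. ennreal ((dist (chain \<rho> K (Suc i) x) (chain \<rho> K i x))\<^sup>2) \<partial>P)
        = (\<Sum>z\<in>Z (Suc i). ennreal ((dist z (\<rho> i z))\<^sup>2) * emeasure P {x \<in> space P. chain \<rho> K (Suc i) x = z})"
        using nn_integral_fibres[OF Z(1)[of "Suc i"] _ sf, of "\<lambda>z. ennreal ((dist z (\<rho> i z))\<^sup>2)"]
          chain_range[of \<rho> Z "Suc i" K] \<rho>(2) i by (auto simp: chain_rec[of i])
      then show ?thesis by (simp add: sum_distrib_left)
    qed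
    also have "\<dots> \<le> ennreal (\<theta> i / 2) * ennreal (V i)"
      using V(2)[OF i] by (intro mult_left_mono) auto
    finally have 1: "(\<Sum>z\<in>Z (Suc i). a i z * (\<integral>\<^sup>+\<omega>. ennreal ((\<Delta> i z \<omega>)\<^sup>2) \<partial>M)) \<le> ennreal (\<theta> i / 2 * V i)"
      using \<theta>i V(1)[OF i] ennreal_mult[of "\<theta> i / 2" "V i"] by simp
    have 2: "(\<Sum>z\<in>Z (Suc i). b i) = ennreal (real (card (Z (Suc i))) / (2 * real n * \<theta> i))"
      using \<theta>i by (simp add: b_def ennreal_of_nat_eq_real_of_nat ennreal_mult[symmetric])
    have "(\<Sum>z\<in>Z (Suc i). a i z * (\<integral>\<^sup>+\<omega>. ennreal ((\<Delta> i z \<omega>)\<^sup>2) \<partial>M) + b i)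
      \<le> ennreal (\<theta> i / 2 * V i) + ennreal (real (card (Z (Suc i))) / (2 * real n * \<theta> i))"
      unfolding sum.distrib 2 by (intro add_right_mono 1)
    also have "\<dots> = ennreal ((\<theta> i * V i + real (card (Z (Suc i))) / (real n * \<theta> i)) / 2)"
      using \<theta>i V(1)[OF i] by (simp add: ennreal_plus[symmetric] add_divide_distrib mult_ac del: ennreal_plus)
    finally show "(\<Sum>z\<in>Z (Suc i). a i z * (\<integral>\<^sup>+\<omega>. ennreal ((\<Delta> i z \<omega>)\<^sup>2) \<partial>M) + b i)
      \<le> ennreal ((\<theta> i * V i + real (card (Z (Suc i))) / (real n * \<theta> i)) / 2)" .
  qed
  also have "\<dots> = ennreal (\<Sum>i<K. (\<theta> i * V i + real (card (Z (Suc i))) / (real n * \<theta> i)) / 2)"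
  proof (rule sum_ennreal)
    show "0 \<le> (\<theta> i * V i + real (card (Z (Suc i))) / (real n * \<theta> i)) / 2" if "i \<in> {..<K}" for i
      using that \<theta>[of i] V(1)[of i] by simp
  qed
  finally show ?thesis by (simp add: E_def R_def mult_2 add_left_mono)
qed

subsection \<open>Covers from the dimension\<close>

text \<open>By well-ordering, the infimum of a nonempty set is a member; a finite infimum rules out
  the empty set. Covering numbers are therefore realised by actual sets and centres, without
  slack.\<close>

lemma enat_INF_attained:
  fixes f :: "'a \<Rightarrow> enat"
  assumes "(INF x\<in>A. f x) \<noteq> \<infinity>"
  shows "\<exists>x\<in>A. f x = (INF x\<in>A. f x)"
proof -
  obtain a where "a \<in> A" using assms by (cases "A = {}") (auto simp: top_enat_def)
  then have "f a \<in> f ` A" by (rule imageI)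
  then have "(LEAST y. y \<in> f ` A) \<in> f ` A" by (rule LeastI)
  moreover have "(LEAST y. y \<in> f ` A) = (INF x\<in>A. f x)"
    using \<open>a \<in> A\<close> unfolding Inf_enat_def by auto
  ultimately have "(INF x\<in>A. f x) \<in> f ` A" by simp
  then obtain x where "x \<in> A" "(INF x\<in>A. f x) = f x" by (rule imageE)
  then show ?thesis by (intro bexI[of _ x]) auto
qed

lemma measure_covering_number_cover:
  assumes "measure_covering_number \<epsilon> P \<tau> = enat k"
  obtains S C where "S \<in> sets borel" "1 - \<tau> \<le> measure P S" "finite C" "card C = k"
    "S \<subseteq> (\<Union>c\<in>C. cball c \<epsilon>)"
proof -
  obtain S where S: "S \<in> sets borel" "measure P S \<ge> 1 - \<tau>" "covering_number \<epsilon> S = enat k"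
    using enat_INF_attained[of "covering_number \<epsilon>" "{S \<in> sets borel. measure P S \<ge> 1 - \<tau>}"] assms
    by (auto simp: measure_covering_number_def)
  moreover obtain C where "finite C" "S \<subseteq> (\<Union>c\<in>C. cball c \<epsilon>)" "card C = k"
    using enat_INF_attained[of "\<lambda>C. enat (card C)" "{C. finite C \<and> S \<subseteq> (\<Union>c\<in>C. cball c \<epsilon>)}"] S(3)
    by (auto simp: covering_number_def)
  ultimately show ?thesis by (intro that[of S C]) auto
qed

lemma covering_dim_less_cover:
  assumes \<epsilon>: "0 < \<epsilon>" "\<epsilon> < 1" and dim: "covering_dim \<epsilon> P \<tau> < ereal t"
  obtains S C where "S \<in> sets borel" "1 - \<tau> \<le> measure P S" "finite C"
    "S \<subseteq> (\<Union>c\<in>C. cball c \<epsilon>)" "real (card C) \<le> \<epsilon> powr (- t)"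
proof -
  have ln: "ln \<epsilon> < 0" using \<epsilon> by simp
  have dim': "- ln_enat (measure_covering_number \<epsilon> P \<tau>) / ereal (ln \<epsilon>) < ereal t"
    using dim unfolding covering_dim_def .
  have "measure_covering_number \<epsilon> P \<tau> \<noteq> \<infinity>"
  proof
    assume "measure_covering_number \<epsilon> P \<tau> = \<infinity>"
    then have "ln_enat (measure_covering_number \<epsilon> P \<tau>) = \<infinity>" by (simp add: ln_enat_def)
    with dim' have "- \<infinity> / ereal (ln \<epsilon>) < ereal t" by simp
    \<comment> \<open>Since \<open>ln \<epsilon>\<close> is negative, an infinite covering number
      means dimension plus infinity.\<close>
    moreover have "- \<infinity> / ereal (ln \<epsilon>) = \<infinity>" using \<epsilon> by (simp add: divide_ereal_def)
    ultimately show False by simp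
  qed
  then obtain k where k: "measure_covering_number \<epsilon> P \<tau> = enat k" by auto
  have "real k \<le> \<epsilon> powr (- t)"
  \<comment> \<open>For \<open>k = 0\<close> the logarithm is the conventional minus infinity, but
    the claim is trivial.\<close>
  proof (cases "k = 0")
    case False
    then have "ln_enat (measure_covering_number \<epsilon> P \<tau>) = ereal (ln (real k))"
      using k by (simp add: ln_enat_def)
    with dim' ln have "- ln (real k) / ln \<epsilon> < t" by (simp del: ln_less_zero_iff)
    then have "t * ln \<epsilon> < - ln (real k)"
      using ln by (simp only: neg_divide_less_eq)
    then have "ln (real k) < - t * ln \<epsilon>" by simp
    then have "exp (ln (real k)) < exp (- t * ln \<epsilon>)" by (simp only: exp_less_cancel_iff)
    moreover have "exp (ln (real k)) = real k" using False by simp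
    moreover have "\<epsilon> powr (- t) = exp (- t * ln \<epsilon>)" using \<epsilon> by (simp add: powr_def)
    ultimately show ?thesis by linarith
  qed simp
  moreover obtain S C where "S \<in> sets borel" "1 - \<tau> \<le> measure P S" "finite C" "card C = k"
    "S \<subseteq> (\<Union>c\<in>C. cball c \<epsilon>)"
    by (rule measure_covering_number_cover[OF k])
  ultimately show ?thesis by (intro that[of S C]) auto
qed

text \<open>Two exponents appear because an upper limit of at most \<open>t\<close> yields a bound
  near 0 only for exponents above \<open>t\<close>: \<open>t\<close> controls the uncovered mass,
  \<open>t'\<close> the number of centres. Both still fit below \<open>s\<close>.\<close>

lemma upper_SW1_dim_less_covers:
  fixes P :: "'a::metric_space measure"
  assumes "upper_SW1_dim P < ereal s"
  obtains t t' \<epsilon>\<^sub>0 where "2 < t" "t < t'" "t' < s" "0 < \<epsilon>\<^sub>0" "\<epsilon>\<^sub>0 < 1"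
    "\<And>\<epsilon>. 0 < \<epsilon> \<Longrightarrow> \<epsilon> \<le> \<epsilon>\<^sub>0 \<Longrightarrow> \<exists>S C. S \<in> sets borel \<and> 1 - \<epsilon> powr (t\<^sup>2 / (t - 2)) \<le> measure P S \<and> finite C \<and>
      S \<subseteq> (\<Union>c\<in>C. cball c \<epsilon>) \<and> real (card C) \<le> \<epsilon> powr (- t')"
proof -
  obtain t where t: "2 < t" "t < s"
    "Limsup (at_right 0) (\<lambda>\<epsilon>. covering_dim \<epsilon> P (\<epsilon> powr (t\<^sup>2 / (t - 2)))) \<le> ereal t"
    using assms unfolding upper_SW1_dim_def Inf_less_iff by auto
  define t' where "t' = (t + s) / 2"
  have t': "t < t'" "t' < s" using t by (auto simp: t'_def)
  have "eventually (\<lambda>\<epsilon>. covering_dim \<epsilon> P (\<epsilon> powr (t\<^sup>2 / (t - 2))) < ereal t') (at_right 0)"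
    using t(3) t' by (intro Limsup_lessD) (auto intro: le_less_trans)
  then obtain b :: real where b: "0 < b"
    "\<And>\<epsilon>. 0 < \<epsilon> \<Longrightarrow> \<epsilon> < b \<Longrightarrow> covering_dim \<epsilon> P (\<epsilon> powr (t\<^sup>2 / (t - 2))) < ereal t'"
    unfolding eventually_at_right_field by auto
  \<comment> \<open>Halving makes \<open>\<epsilon> \<le> \<epsilon>\<^sub>0\<close> imply both
    strict bounds \<open>\<epsilon> < b\<close> and \<open>\<epsilon> < 1\<close>.\<close>
  define \<epsilon>\<^sub>0 where "\<epsilon>\<^sub>0 = min b 1 / 2"
  show ?thesis
  proof (rule that[of t t' \<epsilon>\<^sub>0])
    fix \<epsilon> :: real assume \<epsilon>: "0 < \<epsilon>" "\<epsilon> \<le> \<epsilon>\<^sub>0"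
    then have "\<epsilon> < b" "\<epsilon> < 1" using b(1) by (auto simp: \<epsilon>\<^sub>0_def)
    obtain S C where "S \<in> sets borel" "1 - \<epsilon> powr (t\<^sup>2 / (t - 2)) \<le> measure P S" "finite C"
      "S \<subseteq> (\<Union>c\<in>C. cball c \<epsilon>)" "real (card C) \<le> \<epsilon> powr (- t')"
      by (rule covering_dim_less_cover[OF \<epsilon>(1) \<open>\<epsilon> < 1\<close> b(2)[OF \<epsilon>(1) \<open>\<epsilon> < b\<close>]])
    then show "\<exists>S C. S \<in> sets borel \<and> 1 - \<epsilon> powr (t\<^sup>2 / (t - 2)) \<le> measure P S \<and> finite C \<and>
      S \<subseteq> (\<Union>c\<in>C. cball c \<epsilon>) \<and> real (card C) \<le> \<epsilon> powr (- t')" by blast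
  qed (use t(1) t' b(1) in \<open>auto simp: \<epsilon>\<^sub>0_def\<close>)
qed

section \<open>Measurable projections onto finite sets of centres\<close>

lemma nearest_point_measurable:
  fixes C :: "'a::{metric_space, second_countable_topology} set"
  assumes "finite C" "C \<noteq> {}"
  shows "\<exists>f \<in> borel_measurable borel. range f \<subseteq> C \<and> (\<forall>x. \<forall>c\<in>C. dist x (f x) \<le> dist x c)"
  using assms
proof (induction rule: finite_ne_induct)
  case (singleton c)
  then show ?case by (intro bexI[of _ "\<lambda>_. c"]) auto
next
  case (insert c C)
  then obtain f where f[measurable]: "f \<in> borel_measurable borel" and f': "range f \<subseteq> C"
    "\<And>x c. c \<in> C \<Longrightarrow> dist x (f x) \<le> dist x c" by blast
  show ?case
  proof (intro bexI[of _ "\<lambda>x. if dist x c \<le> dist x (f x) then c else f x"])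
    show "range (\<lambda>x. if dist x c \<le> dist x (f x) then c else f x) \<subseteq> insert c C \<and>
      (\<forall>x. \<forall>c'\<in>insert c C. dist x (if dist x c \<le> dist x (f x) then c else f x) \<le> dist x c')"
      using f' by (auto intro: order_trans)
  qed measurable
qed

text \<open>Points far from all centres go to the origin, which keeps the norm under control.\<close>

lemma truncated_nearest_point:
  fixes C :: "'a::{real_normed_vector, second_countable_topology} set"
  assumes "finite C" "0 \<le> r"
  shows "\<exists>f \<in> borel_measurable borel. range f \<subseteq> insert 0 C \<and> (\<forall>x. norm (f x) \<le> norm x + r) \<and>
    (\<forall>x. \<forall>c\<in>C. dist x c \<le> r \<longrightarrow> dist x (f x) \<le> dist x c)"
proof (cases "C = {}")
  case True
  then show ?thesis using assms by (intro bexI[of _ "\<lambda>_. 0"]) auto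
next
  case False
  with nearest_point_measurable[OF assms(1)] obtain f
    where f[measurable]: "f \<in> borel_measurable borel" and f': "range f \<subseteq> C"
    "\<And>x c. c \<in> C \<Longrightarrow> dist x (f x) \<le> dist x c" by blast
  show ?thesis
  proof (intro bexI[of _ "\<lambda>x. if dist x (f x) \<le> r then f x else 0"] conjI allI ballI impI)
    fix x
    show "norm (if dist x (f x) \<le> r then f x else 0) \<le> norm x + r"
      using assms norm_triangle_ineq2[of "f x" x] by (auto simp: dist_norm norm_minus_commute)
  next
    fix x c assume "c \<in> C" "dist x c \<le> r"
    then show "dist x (if dist x (f x) \<le> r then f x else 0) \<le> dist x c"
      using f'(2)[of c x] by auto
  next
    show "range (\<lambda>x. if dist x (f x) \<le> r then f x else 0) \<subseteq> insert 0 C" using f'(1) by auto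
  next
    show "(\<lambda>x. if dist x (f x) \<le> r then f x else 0) \<in> borel_measurable borel" by measurable
  qed
qed

subsection \<open>Multiscale covers\<close>

text \<open>The projections act on points already moved by finer levels, hence the radius
  \<open>2 * e k\<close> in \<open>\<rho>_near\<close> where the cover has radius
  \<open>e k\<close>. Level 0 is the constant map to the root and is exempt from nearness.\<close>

locale multiscale_cover = prob_space P
  for P :: "'a::{real_normed_vector, second_countable_topology} measure" +
  fixes s m \<beta> t :: real and e :: "nat \<Rightarrow> real" and S C :: "nat \<Rightarrow> 'a set" and \<rho> :: "nat \<Rightarrow> 'a \<Rightarrow> 'a"
  assumes sets_P: "sets P = sets borel"
    and exponents: "2 < t" "t < s" "2 * s / (s - 2) \<le> \<beta>"
    and m: "0 \<le> m" "(\<integral>\<^sup>+x. ennreal (norm x powr s) \<partial>P) = ennreal m"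
    and e0: "0 < e 0" "e 0 \<le> 1" and e_Suc: "\<And>k. e (Suc k) = e k / 4"
    and S: "\<And>k. S k \<in> sets borel" "\<And>k. 1 - e k powr \<beta> \<le> prob (S k)"
    and C: "\<And>k. finite (C k)" "\<And>k. S k \<subseteq> (\<Union>c\<in>C k. cball c (e k))"
      "\<And>k. real (card (C k)) \<le> e k powr (- t)"
    and \<rho>_0: "\<rho> 0 = (\<lambda>_. 0)"
    and \<rho>_measurable: "\<And>k. \<rho> k \<in> borel_measurable borel"
    and \<rho>_range: "\<And>k. range (\<rho> (Suc k)) \<subseteq> insert 0 (C (Suc k))"
    and \<rho>_norm: "\<And>k x. norm (\<rho> k x) \<le> norm x + 2 * e k"
    and \<rho>_near: "\<And>k x c. 0 < k \<Longrightarrow> c \<in> C k \<Longrightarrow> dist x c \<le> 2 * e k \<Longrightarrow> dist x (\<rho> k x) \<le> dist x c"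
begin

lemma space_P [simp]: "space P = UNIV"
  using sets_eq_imp_space_eq[OF sets_P] by simp

lemma e_eq: "e k = e 0 / 4 ^ k"
  by (induction k) (auto simp: e_Suc)

lemma e_pos: "0 < e k"
  using e0 by (simp add: e_eq[of k])

lemma e_le: "e k \<le> 1 / 4 ^ k"
  using e0 by (simp add: e_eq[of k] divide_right_mono)

lemma e_le_1: "e k \<le> 1"
  using e_le[of k] by (rule order_trans) (simp add: divide_le_eq)

abbreviation \<pi> :: "nat \<Rightarrow> nat \<Rightarrow> 'a \<Rightarrow> 'a" where
  "\<pi> \<equiv> chain \<rho>"

text \<open>A point is lost as soon as one level from \<open>k\<close> to \<open>K\<close> misses
  it, since every later projection inherits the error. For \<open>k = Suc K\<close> the set is
  empty.\<close>

definition escape :: "nat \<Rightarrow> nat \<Rightarrow> 'a set" where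
  "escape K k = (\<Union>j\<in>{k..K}. - S j)"

lemma escape_rec: "k \<le> K \<Longrightarrow> escape K k = - S k \<union> escape K (Suc k)"
  unfolding escape_def by (auto simp: atLeastAtMost_insertL[symmetric])

lemma escape_measurable [measurable]: "escape K k \<in> sets borel"
  using S unfolding escape_def by auto

text \<open>As \<open>\<beta>\<close> is at least 1, uncovered masses shrink by a factor 4 or more
  per level, so all finer levels together cost at most as much as level \<open>k\<close>.\<close>

lemma prob_escape:
  assumes "k \<le> Suc K"
  shows "prob (escape K k) \<le> 2 * e k powr \<beta>"
  using assms
proof (induction rule: inc_induct)
  case base
  then show ?case by (simp add: escape_def)
next
  case (step k)
  have "1 \<le> \<beta>"
  proof -
    have "2 \<le> 2 * s / (s - 2)" using exponents by (simp add: le_divide_eq)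
    with exponents show ?thesis by linarith
  qed
  have "(4::real) powr 1 \<le> 4 powr \<beta>" using \<open>1 \<le> \<beta>\<close> by (intro powr_mono) auto
  then have "e k powr \<beta> / 4 powr \<beta> \<le> e k powr \<beta> / 4" by (intro divide_left_mono) auto
  then have "e (Suc k) powr \<beta> \<le> e k powr \<beta> / 4"
    unfolding e_Suc using e_pos[of k] by (simp add: powr_divide)
  moreover have "prob (escape K k) \<le> prob (- S k) + prob (escape K (Suc k))"
    using S sets_P step by (subst escape_rec) (auto intro!: measure_Un_le)
  moreover have "prob (- S k) \<le> e k powr \<beta>"
    using prob_compl[of "S k"] S(1)[of k] S(2)[of k] sets_P by (simp add: Compl_eq_Diff_UNIV)
  moreover have "0 \<le> e k powr \<beta>" by simp
  ultimately show ?case using step.IH by linarith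
qed

text \<open>Here the ratio 4 closes the induction: the incoming error \<open>2 * e (Suc k)\<close>
  is \<open>e k / 2\<close>, a centre then lies within \<open>3 / 2 * e k\<close> of the moved
  point, and the total is \<open>2 * e k\<close>.\<close>

lemma dist_chain_le:
  assumes "k \<le> Suc K" "0 < k" "x \<notin> escape K k"
  shows "dist x (\<pi> K k x) \<le> 2 * e k"
  using assms
proof (induction rule: inc_induct)
  case base
  then show ?case using e_pos[of "Suc K"] by (simp add: chain_beyond)
next
  case (step k)
  define y where "y = \<pi> K (Suc k) x"
  have y: "dist x y \<le> e k / 2" using step by (simp add: y_def escape_rec e_Suc)
  have "x \<in> S k" using step by (auto simp: escape_rec)
  then obtain c where c: "c \<in> C k" "dist x c \<le> e k"
    using C(2)[of k] by (auto simp: dist_commute)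
  have yc: "dist y c \<le> e k / 2 + e k"
    using dist_triangle[of y c x] y c by (simp add: dist_commute)
  then have "dist y (\<rho> k y) \<le> e k / 2 + e k"
    using \<rho>_near[of k c y] c step e_pos[of k] by linarith
  then have "dist x (\<rho> k y) \<le> 2 * e k"
    using dist_triangle[of x "\<rho> k y" y] y by linarith
  then show ?case using step by (simp add: chain_rec y_def)
qed

text \<open>The substitute for nearness on the escape set. The increments form a geometric series:
  \<open>4 * e (Suc k) + 2 * e k\<close> is \<open>3 * e k\<close>.\<close>

lemma norm_chain_le:
  assumes "k \<le> Suc K"
  shows "norm (\<pi> K k x) \<le> norm x + 4 * e k"
  using assms
proof (induction rule: inc_induct)
  case base
  then show ?case using e_pos[of "Suc K"] by (simp add: chain_beyond)
next
  case (step k)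
  then show ?case
    using \<rho>_norm[of k "\<pi> K (Suc k) x"] e_pos[of k] by (simp add: chain_rec e_Suc)
qed

text \<open>Beyond the level \<open>l\<close>, write the square as
  \<open>r powr (2 - s) * r powr s\<close>, whose first factor decreases in
  \<open>r\<close>.\<close>

lemma square_le_truncated_powr:
  assumes "0 < l" "0 \<le> r"
  shows "r\<^sup>2 \<le> l\<^sup>2 + l powr (2 - s) * r powr s"
proof (cases "r \<le> l")
  case True
  then have "r\<^sup>2 \<le> l\<^sup>2" using assms by (intro power_mono) auto
  moreover have "0 \<le> l powr (2 - s) * r powr s" by simp
  ultimately show ?thesis by linarith
next
  case False
  then have r: "0 < r" using assms by linarith
  have "r powr (2 - s) \<le> l powr (2 - s)"
    using False assms exponents by (intro powr_mono2') auto
  then have "r powr (2 - s) * r powr s \<le> l powr (2 - s) * r powr s"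
    by (intro mult_right_mono) auto
  moreover have "r powr (2 - s) * r powr s = r\<^sup>2"
    using r by (simp add: powr_add[symmetric])
  ultimately show ?thesis using zero_le_power2[of l] by linarith
qed

text \<open>On the escape set the truncation level \<open>e k powr (- 2 / (s - 2))\<close> makes both parts of
  the bound for \<open>norm x\<^sup>2\<close> of order \<open>(e k)\<^sup>2\<close>; this is where \<open>\<beta>\<close> has to be large.\<close>

lemma second_moment_chain_pos:
  assumes k: "0 < k" "k \<le> Suc K"
  shows "(\<integral>\<^sup>+x. ennreal ((dist x (\<pi> K k x))\<^sup>2) \<partial>P) \<le> ennreal ((52 + 8 * m) * (e k)\<^sup>2)"
proof -
  define l where "l = e k powr (- 2 / (s - 2))"
  have s2: "0 < s - 2" using exponents by simp
  have l: "0 < l" using e_pos[of k] by (simp add: l_def)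
  have l1: "l powr (2 - s) = (e k)\<^sup>2"
  proof -
    have "l powr (2 - s) = e k powr (- 2 / (s - 2) * (2 - s))"
      unfolding l_def by (rule powr_powr)
    also have "- 2 / (s - 2) * (2 - s) = 2" using s2 by (simp add: field_simps)
    finally show ?thesis using e_pos[of k] by simp
  qed
  have l2: "l\<^sup>2 * e k powr \<beta> \<le> (e k)\<^sup>2"
  proof -
    have "l\<^sup>2 * e k powr \<beta> = e k powr (- 2 / (s - 2) * 2) * e k powr \<beta>"
    proof -
      have "l\<^sup>2 = l powr 2" using l by simp
      also have "\<dots> = e k powr (- 2 / (s - 2) * 2)" unfolding l_def by (rule powr_powr)
      finally show ?thesis by simp
    qed
    also have "\<dots> = e k powr (- 2 / (s - 2) * 2 + \<beta>)" by (rule powr_add[symmetric])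
    also have "\<dots> \<le> e k powr 2"
    proof (rule powr_mono')
      \<comment> \<open>The needed exponent inequality is the locale's lower bound on
        \<open>\<beta>\<close> in another form.\<close>
      have "2 * s / (s - 2) = 2 + 4 / (s - 2)" using s2 by (simp add: field_simps)
      then show "2 \<le> - 2 / (s - 2) * 2 + \<beta>" using exponents by simp
    qed (use e_pos[of k] e_le_1[of k] in auto)
    finally show ?thesis using e_pos[of k] by simp
  qed
  \<comment> \<open>A common bound for both cases: 32, from squaring
    \<open>2 * norm x + 4 * e k\<close> on the escape set, and 4 off it both fit under 36.\<close>
  have pointwise: "(dist x (\<pi> K k x))\<^sup>2
    \<le> 36 * (e k)\<^sup>2 + 8 * l\<^sup>2 * indicator (escape K k) x + 8 * (e k)\<^sup>2 * norm x powr s" for x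
  proof (cases "x \<in> escape K k")
    case True
    have "dist x (\<pi> K k x) \<le> 2 * norm x + 4 * e k"
      using norm_triangle_ineq4[of x "\<pi> K k x"] norm_chain_le[OF k(2), of x] by (simp add: dist_norm)
    then have "(dist x (\<pi> K k x))\<^sup>2 \<le> (2 * norm x + 4 * e k)\<^sup>2" by (intro power_mono) auto
    also have "\<dots> \<le> 8 * (norm x)\<^sup>2 + 32 * (e k)\<^sup>2"
      using zero_le_power2[of "2 * norm x - 4 * e k"] by (simp add: power2_eq_square algebra_simps)
    also have "\<dots> \<le> 8 * (l\<^sup>2 + (e k)\<^sup>2 * norm x powr s) + 32 * (e k)\<^sup>2"
      using square_le_truncated_powr[OF l norm_ge_zero[of x]] l1 by simp
    finally have "(dist x (\<pi> K k x))\<^sup>2 \<le> 32 * (e k)\<^sup>2 + 8 * l\<^sup>2 + 8 * (e k)\<^sup>2 * norm x powr s"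
      by (simp add: algebra_simps)
    also have "\<dots> \<le> 36 * (e k)\<^sup>2 + 8 * l\<^sup>2 + 8 * (e k)\<^sup>2 * norm x powr s" by simp
    finally show ?thesis using True by simp
  next
    case False
    then have "(dist x (\<pi> K k x))\<^sup>2 \<le> (2 * e k)\<^sup>2"
      using dist_chain_le[of k K x] k by (intro power_mono) auto
    also have "\<dots> = 4 * (e k)\<^sup>2" by (simp add: power_mult_distrib)
    also have "\<dots> \<le> 36 * (e k)\<^sup>2 + 8 * (e k)\<^sup>2 * norm x powr s"
      by (intro add_increasing2) auto
    finally show ?thesis using False by simp
  qed
  note [measurable_cong] = sets_P
  have "(\<integral>\<^sup>+x. ennreal ((dist x (\<pi> K k x))\<^sup>2) \<partial>P)
    \<le> (\<integral>\<^sup>+x. ennreal (36 * (e k)\<^sup>2) + ennreal (8 * l\<^sup>2) * indicator (escape K k) x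
      + ennreal (8 * (e k)\<^sup>2) * ennreal (norm x powr s) \<partial>P)"
  proof (intro nn_integral_mono)
    fix x
    have "ennreal ((dist x (\<pi> K k x))\<^sup>2) \<le> ennreal (36 * (e k)\<^sup>2
        + 8 * l\<^sup>2 * indicator (escape K k) x + 8 * (e k)\<^sup>2 * norm x powr s)"
      using pointwise by (rule ennreal_leI)
    also have "\<dots> = ennreal (36 * (e k)\<^sup>2) + ennreal (8 * l\<^sup>2) * indicator (escape K k) x
      + ennreal (8 * (e k)\<^sup>2) * ennreal (norm x powr s)"
      by (simp add: ennreal_mult' indicator_def)
    finally show "ennreal ((dist x (\<pi> K k x))\<^sup>2) \<le> ennreal (36 * (e k)\<^sup>2)
      + ennreal (8 * l\<^sup>2) * indicator (escape K k) x
      + ennreal (8 * (e k)\<^sup>2) * ennreal (norm x powr s)" .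
  qed
  also have "\<dots> = ennreal (36 * (e k)\<^sup>2) + ennreal (8 * l\<^sup>2) * emeasure P (escape K k)
      + ennreal (8 * (e k)\<^sup>2) * ennreal m"
    using sets_P by (simp add: nn_integral_add nn_integral_cmult nn_integral_cmult_indicator
        emeasure_space_1[simplified] m)
  also have "\<dots> = ennreal (36 * (e k)\<^sup>2 + 8 * l\<^sup>2 * prob (escape K k) + 8 * (e k)\<^sup>2 * m)"
    using m by (simp add: emeasure_eq_measure ennreal_mult)
  also have "\<dots> \<le> ennreal ((52 + 8 * m) * (e k)\<^sup>2)"
  proof (rule ennreal_leI)
    \<comment> \<open>The escape probability brings another \<open>16 * (e k)\<^sup>2\<close>, so 36
      becomes 52.\<close>
    have "8 * l\<^sup>2 * prob (escape K k) \<le> 8 * l\<^sup>2 * (2 * e k powr \<beta>)"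
      using prob_escape[OF k(2)] by (intro mult_left_mono) auto
    then show "36 * (e k)\<^sup>2 + 8 * l\<^sup>2 * prob (escape K k) + 8 * (e k)\<^sup>2 * m \<le> (52 + 8 * m) * (e k)\<^sup>2"
      using l2 by (simp add: algebra_simps)
  qed
  finally show ?thesis .
qed

text \<open>The last summand covers level 0, where the distance to the origin is not small but has
  second moment at most \<open>1 + m\<close>. With it one constant, independent of \<open>K\<close>,
  serves all levels.\<close>

definition B :: real where
  "B = 52 + 8 * m + (1 + m) / (e 0)\<^sup>2"

lemma B_nonneg: "0 \<le> B"
  using m e0 by (simp add: B_def)

lemma second_moment_chain:
  assumes "k \<le> Suc K"
  shows "(\<integral>\<^sup>+x. ennreal ((dist x (\<pi> K k x))\<^sup>2) \<partial>P) \<le> ennreal (B * (e k)\<^sup>2)"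
proof (cases "k = 0")
  case True
  note [measurable_cong] = sets_P
  have "(\<integral>\<^sup>+x. ennreal ((dist x (\<pi> K k x))\<^sup>2) \<partial>P) \<le> (\<integral>\<^sup>+x. 1 + ennreal (norm x powr s) \<partial>P)"
  proof (intro nn_integral_mono)
    fix x
    have "ennreal ((dist x (\<pi> K k x))\<^sup>2) = ennreal ((norm x)\<^sup>2)"
      using True by (simp add: chain_rec \<rho>_0)
    also have "\<dots> \<le> ennreal (1 + norm x powr s)"
      using square_le_truncated_powr[of 1 "norm x"] by (intro ennreal_leI) simp
    finally show "ennreal ((dist x (\<pi> K k x))\<^sup>2) \<le> 1 + ennreal (norm x powr s)" by simp
  qed
  also have "\<dots> = ennreal (1 + m)"
    using m by (simp add: nn_integral_add emeasure_space_1[simplified])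
  also have "\<dots> \<le> ennreal (B * (e k)\<^sup>2)"
  proof (rule ennreal_leI)
    have "1 + m = (1 + m) / (e 0)\<^sup>2 * (e 0)\<^sup>2" using e0 by simp
    also have "\<dots> \<le> B * (e 0)\<^sup>2" using m by (intro mult_right_mono) (auto simp: B_def)
    finally show "1 + m \<le> B * (e k)\<^sup>2" using True by simp
  qed
  finally show ?thesis .
next
  case False
  have "(52 + 8 * m) * (e k)\<^sup>2 \<le> B * (e k)\<^sup>2"
    using m by (intro mult_right_mono) (auto simp: B_def)
  then have "ennreal ((52 + 8 * m) * (e k)\<^sup>2) \<le> ennreal (B * (e k)\<^sup>2)" by (rule ennreal_leI)
  with False assms second_moment_chain_pos[of k K] show ?thesis by (auto intro: order_trans)
qed

lemma second_moment_step:
  assumes "i < K"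
  shows "(\<integral>\<^sup>+x. ennreal ((dist (\<pi> K (Suc i) x) (\<pi> K i x))\<^sup>2) \<partial>P) \<le> ennreal (4 * B * (e i)\<^sup>2)"
proof -
  have [measurable]: "(\<lambda>x. \<pi> K k x) \<in> borel_measurable borel" if "k \<le> Suc K" for k
    using chain_measurable[OF \<rho>_measurable that] .
  note [measurable_cong] = sets_P
  have "(\<integral>\<^sup>+x. ennreal ((dist (\<pi> K (Suc i) x) (\<pi> K i x))\<^sup>2) \<partial>P)
    \<le> (\<integral>\<^sup>+x. 2 * ennreal ((dist x (\<pi> K (Suc i) x))\<^sup>2) + 2 * ennreal ((dist x (\<pi> K i x))\<^sup>2) \<partial>P)"
  proof (intro nn_integral_mono)
    fix x
    define a b where "a = dist x (\<pi> K (Suc i) x)" and "b = dist x (\<pi> K i x)"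
    have "dist (\<pi> K (Suc i) x) (\<pi> K i x) \<le> a + b"
      unfolding a_def b_def by (rule dist_triangle3)
    then have "(dist (\<pi> K (Suc i) x) (\<pi> K i x))\<^sup>2 \<le> (a + b)\<^sup>2" by (intro power_mono) auto
    also have "\<dots> \<le> 2 * a\<^sup>2 + 2 * b\<^sup>2"
      using zero_le_power2[of "a - b"] by (simp add: power2_eq_square algebra_simps)
    finally have "ennreal ((dist (\<pi> K (Suc i) x) (\<pi> K i x))\<^sup>2) \<le> ennreal (2 * a\<^sup>2 + 2 * b\<^sup>2)"
      by (rule ennreal_leI)
    then show "ennreal ((dist (\<pi> K (Suc i) x) (\<pi> K i x))\<^sup>2)
      \<le> 2 * ennreal (a\<^sup>2) + 2 * ennreal (b\<^sup>2)" by (simp add: ennreal_mult)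
  qed
  also have "\<dots> = 2 * (\<integral>\<^sup>+x. ennreal ((dist x (\<pi> K (Suc i) x))\<^sup>2) \<partial>P)
      + 2 * (\<integral>\<^sup>+x. ennreal ((dist x (\<pi> K i x))\<^sup>2) \<partial>P)"
    using assms by (simp add: nn_integral_add nn_integral_cmult)
  also have "\<dots> \<le> 2 * ennreal (B * (e (Suc i))\<^sup>2) + 2 * ennreal (B * (e i)\<^sup>2)"
    using assms by (intro add_mono mult_left_mono second_moment_chain) auto
  also have "\<dots> = ennreal (2 * (B * (e (Suc i))\<^sup>2) + 2 * (B * (e i)\<^sup>2))"
    using B_nonneg by (simp add: ennreal_mult)
  also have "\<dots> \<le> ennreal (4 * B * (e i)\<^sup>2)"
  proof (rule ennreal_leI)
    have "(e (Suc i))\<^sup>2 \<le> (e i)\<^sup>2" using e_pos[of i] by (intro power_mono) (auto simp: e_Suc)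
    from mult_left_mono[OF this B_nonneg]
    show "2 * (B * (e (Suc i))\<^sup>2) + 2 * (B * (e i)\<^sup>2) \<le> 4 * B * (e i)\<^sup>2" by simp
  qed
  finally show ?thesis .
qed

text \<open>Weighted squares again, with weight \<open>1 / e K\<close>: as the second moment is of
  order \<open>(e K)\<^sup>2\<close>, both resulting terms are of order \<open>e K\<close>.\<close>

lemma first_moment_finest:
  "(\<integral>\<^sup>+x. ennreal (dist x (\<rho> K x)) \<partial>P) \<le> ennreal ((1 + B) / 2 * e K)"
proof -
  note [measurable_cong] = sets_P
  note [measurable] = \<rho>_measurable
  define c where "c = e K"
  have c: "0 < c" using e_pos by (simp add: c_def)
  have "(\<integral>\<^sup>+x. ennreal (dist x (\<rho> K x)) \<partial>P)
    \<le> (\<integral>\<^sup>+x. ennreal (c / 2) + ennreal (1 / (2 * c)) * ennreal ((dist x (\<rho> K x))\<^sup>2) \<partial>P)"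
  proof (intro nn_integral_mono)
    fix x
    have "dist x (\<rho> K x) \<le> c / 2 + 1 / (2 * c) * (dist x (\<rho> K x))\<^sup>2"
      using mult_le_weighted_squares[of "1 / c" "dist x (\<rho> K x)" 1] c by (simp add: field_simps)
    then have "ennreal (dist x (\<rho> K x)) \<le> ennreal (c / 2 + 1 / (2 * c) * (dist x (\<rho> K x))\<^sup>2)"
      by (rule ennreal_leI)
    then show "ennreal (dist x (\<rho> K x)) \<le> ennreal (c / 2) + ennreal (1 / (2 * c)) * ennreal ((dist x (\<rho> K x))\<^sup>2)"
      using c by (simp add: ennreal_mult[symmetric] ennreal_plus[symmetric] del: ennreal_plus)
  qed
  also have "\<dots> = ennreal (c / 2) + ennreal (1 / (2 * c)) * (\<integral>\<^sup>+x. ennreal ((dist x (\<rho> K x))\<^sup>2) \<partial>P)"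
    by (simp add: nn_integral_add nn_integral_cmult emeasure_space_1[simplified])
  also have "\<dots> \<le> ennreal (c / 2) + ennreal (1 / (2 * c)) * ennreal (B * c\<^sup>2)"
    using second_moment_chain[of K K] by (intro add_left_mono mult_left_mono) (auto simp: chain_top c_def)
  also have "\<dots> = ennreal (c / 2 + 1 / (2 * c) * (B * c\<^sup>2))"
    using c B_nonneg by (simp add: ennreal_mult[symmetric] ennreal_plus[symmetric] del: ennreal_plus)
  also have "c / 2 + 1 / (2 * c) * (B * c\<^sup>2) = (1 + B) / 2 * c"
    using c by (simp add: field_simps power2_eq_square)
  finally show ?thesis by (simp add: c_def)
qed

section \<open>Choice of weights and summation over the scales\<close>

lemma expected_wasserstein1_multiscale:
  assumes iid: "iid_samples M n X P" and n: "0 < n"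
  shows "(\<integral>\<^sup>+\<omega>. wasserstein1 (empirical_measure n (\<lambda>i. X i \<omega>)) P \<partial>M)
    \<le> ennreal ((1 + B) * e K + (\<Sum>i<K. (8 * B + 4) * e (Suc i) powr (1 - t / 2) * real n powr (- (1 / 2))))"
proof -
  define Z where "Z i = (if i = 0 then {0} else insert 0 (C i))" for i
  \<comment> \<open>\<open>g i\<close> is the square root of the bound on the number of centres
    divided by \<open>n\<close>. The weight \<open>g i / e i\<close> balances the two terms of a
    level: both become multiples of \<open>g i * e i\<close>.\<close>
  define g where "g i = e (Suc i) powr (- t / 2) * real n powr (- (1 / 2))" for i
  have g: "0 < g i" for i using e_pos[of "Suc i"] n by (simp add: g_def)
  have g2: "(g i)\<^sup>2 = e (Suc i) powr (- t) / real n" for i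
  proof -
    have "(x powr a)\<^sup>2 = x powr (2 * a)" for x a :: real
      by (simp only: power2_eq_square powr_add[symmetric] mult_2)
    moreover have "real n powr (- 1) = 1 / real n" using n by (simp add: powr_minus_divide)
    ultimately show ?thesis by (simp add: g_def power_mult_distrib)
  qed
  \<comment> \<open>The factor 2 absorbs the origin added to the centres, as
    \<open>e (Suc i) powr (- t)\<close> is at least 1.\<close>
  have cardZ: "real (card (Z (Suc i))) \<le> 2 * (real n * (g i)\<^sup>2)" for i
  proof -
    have "1 = e (Suc i) powr 0" using e_pos[of "Suc i"] by simp
    also have "\<dots> \<le> e (Suc i) powr (- t)"
      using e_pos[of "Suc i"] e_le_1[of "Suc i"] exponents by (intro powr_mono') auto
    finally have "1 \<le> e (Suc i) powr (- t)" .
    moreover have "real (card (Z (Suc i))) \<le> real (card (C (Suc i))) + 1"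
      using C(1)[of "Suc i"] by (simp add: Z_def card_insert_if)
    ultimately show ?thesis using C(3)[of "Suc i"] n by (simp add: g2)
  qed
  have "(\<integral>\<^sup>+\<omega>. wasserstein1 (empirical_measure n (\<lambda>i. X i \<omega>)) P \<partial>M)
    \<le> 2 * (\<integral>\<^sup>+x. ennreal (dist x (\<rho> K x)) \<partial>P)
      + ennreal (\<Sum>i<K. (g i / e i * (4 * B * (e i)\<^sup>2) + real (card (Z (Suc i))) / (real n * (g i / e i))) / 2)"
  proof (rule expected_wasserstein1_chain_bound[OF prob_space_axioms sets_P iid n, where c=0])
    show "range (\<rho> i) \<subseteq> Z i" for i
      using \<rho>_range \<rho>_0 by (cases i) (auto simp: Z_def)
  qed (use \<rho>_measurable C g e_pos B_nonneg second_moment_step in \<open>auto simp: Z_def\<close>)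
  also have "\<dots> \<le> ennreal ((1 + B) * e K) +
    ennreal (\<Sum>i<K. (8 * B + 4) * e (Suc i) powr (1 - t / 2) * real n powr (- (1 / 2)))"
  proof (intro add_mono ennreal_leI sum_mono)
    have "2 * (\<integral>\<^sup>+x. ennreal (dist x (\<rho> K x)) \<partial>P) \<le> 2 * ennreal ((1 + B) / 2 * e K)"
      by (intro mult_left_mono first_moment_finest) auto
    also have "\<dots> = ennreal (2 * ((1 + B) / 2 * e K))"
      using B_nonneg e_pos[of K] by (subst ennreal_mult) auto
    finally show "2 * (\<integral>\<^sup>+x. ennreal (dist x (\<rho> K x)) \<partial>P) \<le> ennreal ((1 + B) * e K)" by simp
  next
    fix i
    have "real (card (Z (Suc i))) / (real n * (g i / e i)) \<le> 2 * (real n * (g i)\<^sup>2) / (real n * (g i / e i))"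
      using cardZ[of i] g[of i] e_pos[of i] n by (intro divide_right_mono) auto
    also have "\<dots> = 2 * (g i * e i)"
      using g[of i] e_pos[of i] n by (simp add: field_simps power2_eq_square)
    finally have card_term: "real (card (Z (Suc i))) / (real n * (g i / e i)) \<le> 2 * (g i * e i)" .
    have "g i / e i * (4 * B * (e i)\<^sup>2) = 4 * B * (g i * e i)"
      using e_pos[of i] by (simp add: power2_eq_square)
    with card_term have "(g i / e i * (4 * B * (e i)\<^sup>2) + real (card (Z (Suc i))) / (real n * (g i / e i))) / 2
      \<le> (4 * B * (g i * e i) + 2 * (g i * e i)) / 2"
      by (intro divide_right_mono add_mono) auto
    \<comment> \<open>Rewriting \<open>e i\<close> as \<open>4 * e (Suc i)\<close> turns
      \<open>2 * B + 1\<close> into \<open>8 * B + 4\<close>.\<close>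
    also have "\<dots> = (8 * B + 4) * (e (Suc i) * g i)"
      by (simp add: e_Suc algebra_simps)
    also have "e (Suc i) * g i = e (Suc i) powr (1 - t / 2) * real n powr (- (1 / 2))"
    proof -
      have "e (Suc i) powr (1 - t / 2) = e (Suc i) powr 1 * e (Suc i) powr (- t / 2)"
        by (simp only: powr_add[symmetric]) simp
      then show ?thesis using e_pos[of "Suc i"] by (simp add: g_def)
    qed
    finally show "(g i / e i * (4 * B * (e i)\<^sup>2) + real (card (Z (Suc i))) / (real n * (g i / e i))) / 2
      \<le> (8 * B + 4) * e (Suc i) powr (1 - t / 2) * real n powr (- (1 / 2))" by (simp add: mult.assoc)
  qed
  also have "\<dots> = ennreal ((1 + B) * e K + (\<Sum>i<K. (8 * B + 4) * e (Suc i) powr (1 - t / 2) * real n powr (- (1 / 2))))"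
    using B_nonneg e_pos[of K] by (intro ennreal_plus[symmetric] sum_nonneg) auto
  finally show ?thesis .
qed

text \<open>The covers are fixed once for all scales and only the stopping level depends on
  \<open>n\<close>; this is why \<open>c\<close> can precede the quantifiers over \<open>n\<close>,
  \<open>M\<close> and \<open>X\<close>.\<close>

lemma expected_wasserstein1_rate:
  "\<exists>c::real. \<forall>n\<ge>1. \<forall>(M :: 'w measure) X. iid_samples M n X P \<longrightarrow>
     (\<integral>\<^sup>+\<omega>. wasserstein1 (empirical_measure n (\<lambda>i. X i \<omega>)) P \<partial>M)
       \<le> ennreal (c * real n powr (- (1 / s)))"
proof -
  \<comment> \<open>The gap between \<open>t\<close> and \<open>s\<close>:
    \<open>1 - t / 2 = \<delta> + (1 - s / 2)\<close>. The power \<open>\<delta>\<close> of the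
    scale produces the factor \<open>r ^ i\<close>, the remaining power is bounded at the finest
    scale.\<close>
  define \<delta> where "\<delta> = (s - t) / 2"
  have \<delta>: "0 < \<delta>" using exponents by (simp add: \<delta>_def)
  define r where "r = (1 / 4 :: real) powr \<delta>"
  have r: "0 < r" "r < 1"
    using \<delta> powr_less_mono2[of \<delta> "1/4" 1] by (auto simp: r_def)
  define c where "c = (1 + B) + (8 * B + 4) * 4 powr (s / 2 - 1) * (1 / (1 - r))"
  have bound: "(\<integral>\<^sup>+\<omega>. wasserstein1 (empirical_measure n (\<lambda>i. X i \<omega>)) P \<partial>M)
       \<le> ennreal (c * real n powr (- (1 / s)))"
    if n: "1 \<le> n" and iid: "iid_samples M n X P" for n and M :: "'w measure" and X
  proof -
    define \<eta> where "\<eta> = real n powr (- (1 / s))"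
    have \<eta>: "0 < \<eta>" using n by (simp add: \<eta>_def)
    have "\<exists>k. e k \<le> \<eta>"
    proof -
      obtain k where "(1 / 4 :: real) ^ k < \<eta>" using real_arch_pow_inv[of \<eta> "1/4"] \<eta> by auto
      then show ?thesis using e_le[of k] by (intro exI[of _ k]) (simp add: power_divide)
    qed
    \<comment> \<open>Minimality gives \<open>\<eta> < e i\<close> for \<open>i < K\<close>, hence
      \<open>\<eta> / 4 \<le> e (Suc i)\<close> even when \<open>Suc i = K\<close>. If
      \<open>e 0 \<le> \<eta>\<close> already, then \<open>K = 0\<close> and the sum is
      empty.\<close>
    define K where "K = (LEAST k. e k \<le> \<eta>)"
    have eK: "e K \<le> \<eta>" unfolding K_def using \<open>\<exists>k. e k \<le> \<eta>\<close> by (rule LeastI_ex)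
    have term_le: "(8 * B + 4) * e (Suc i) powr (1 - t / 2) * real n powr (- (1 / 2))
      \<le> (8 * B + 4) * 4 powr (s / 2 - 1) * \<eta> * r ^ i" if "i < K" for i
    proof -
      have "\<eta> < e i" using not_less_Least[of i "\<lambda>k. e k \<le> \<eta>"] that by (simp add: K_def)
      then have big: "\<eta> / 4 \<le> e (Suc i)" by (simp add: e_Suc)
      have "e (Suc i) powr (1 - t / 2) = e (Suc i) powr \<delta> * e (Suc i) powr (1 - s / 2)"
      proof -
        have "1 - t / 2 = \<delta> + (1 - s / 2)" by (simp add: \<delta>_def field_simps)
        then show ?thesis by (simp only: powr_add)
      qed
      also have "\<dots> \<le> r ^ i * (4 powr (s / 2 - 1) * \<eta> powr (1 - s / 2))"
      proof (intro mult_mono)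
        have "e (Suc i) \<le> (1 / 4) ^ i"
          using e_le[of i] e_pos[of i] by (simp add: e_Suc power_divide)
        then have "e (Suc i) powr \<delta> \<le> ((1 / 4) ^ i) powr \<delta>"
          using \<delta> e_pos[of "Suc i"] by (intro powr_mono2) auto
        also have "\<dots> = r ^ i"
          unfolding r_def by (simp add: powr_powr powr_realpow[symmetric] mult.commute)
        finally show "e (Suc i) powr \<delta> \<le> r ^ i" .
        have "e (Suc i) powr (1 - s / 2) \<le> (\<eta> / 4) powr (1 - s / 2)"
          using big \<eta> exponents by (intro powr_mono2') auto
        also have "\<dots> = 4 powr (s / 2 - 1) * \<eta> powr (1 - s / 2)"
          using \<eta> powr_minus_divide[of 4 "s / 2 - 1"] by (simp add: powr_divide)
        finally show "e (Suc i) powr (1 - s / 2) \<le> 4 powr (s / 2 - 1) * \<eta> powr (1 - s / 2)" .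
      qed (use r in auto)
      finally have "e (Suc i) powr (1 - t / 2) * real n powr (- (1 / 2))
        \<le> r ^ i * (4 powr (s / 2 - 1) * \<eta> powr (1 - s / 2)) * real n powr (- (1 / 2))"
        by (intro mult_right_mono) auto
      also have "\<dots> = 4 powr (s / 2 - 1) * \<eta> * r ^ i"
      proof -
        \<comment> \<open>The choice of \<open>\<eta>\<close> balances the two kinds of error: this
          product is \<open>\<eta>\<close> again, the size of the projection error.\<close>
        have "\<eta> powr (1 - s / 2) * real n powr (- (1 / 2)) = real n powr (- (1 / s) * (1 - s / 2) + - (1 / 2))"
          unfolding \<eta>_def powr_powr powr_add ..
        also have "- (1 / s) * (1 - s / 2) + - (1 / 2) = - (1 / s)"
          using exponents by (simp add: field_simps)
        finally show ?thesis by (simp add: \<eta>_def mult_ac)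
      qed
      finally show ?thesis
        using B_nonneg mult_left_mono[of _ _ "8 * B + 4"] by (simp add: mult.assoc)
    qed
    have "(\<Sum>i<K. (8 * B + 4) * e (Suc i) powr (1 - t / 2) * real n powr (- (1 / 2)))
      \<le> (\<Sum>i<K. (8 * B + 4) * 4 powr (s / 2 - 1) * \<eta> * r ^ i)"
      using term_le by (intro sum_mono) auto
    also have "\<dots> = (8 * B + 4) * 4 powr (s / 2 - 1) * \<eta> * (\<Sum>i<K. r ^ i)"
      by (simp add: sum_distrib_left)
    also have "\<dots> \<le> (8 * B + 4) * 4 powr (s / 2 - 1) * \<eta> * (1 / (1 - r))"
    proof (intro mult_left_mono)
      show "(\<Sum>i<K. r ^ i) \<le> 1 / (1 - r)"
        using r by (simp add: sum_gp_strict divide_right_mono)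
    qed (use B_nonneg \<eta> in auto)
    finally have "(1 + B) * e K + (\<Sum>i<K. (8 * B + 4) * e (Suc i) powr (1 - t / 2) * real n powr (- (1 / 2)))
      \<le> (1 + B) * \<eta> + (8 * B + 4) * 4 powr (s / 2 - 1) * \<eta> * (1 / (1 - r))"
      using eK B_nonneg by (intro add_mono mult_left_mono) auto
    also have "\<dots> = c * \<eta>" by (simp add: c_def algebra_simps)
    finally show ?thesis
      using expected_wasserstein1_multiscale[OF iid, of K] n unfolding \<eta>_def
      by (auto intro: order_trans ennreal_leI)
  qed
  then show ?thesis by blast
qed

end

theorem corollary6:
  fixes P :: "(real ^ 'd) measure" and s :: real
  assumes "prob_space P" and "sets P = sets borel"
    and "2 < s"
    and "(\<integral>\<^sup>+ x. ennreal (norm x powr s) \<partial>P) < \<infinity>"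
    and "upper_SW1_dim P < ereal s"
  shows "\<exists>C::real. \<forall>n\<ge>1. \<forall>(M :: 'w measure) X. iid_samples M n X P \<longrightarrow>
           (\<integral>\<^sup>+ \<omega>. wasserstein1 (empirical_measure n (\<lambda>i. X i \<omega>)) P \<partial>M)
             \<le> ennreal (C * real n powr (- (1 / s)))"
proof -
  interpret prob_space P by fact
  obtain u t \<epsilon>\<^sub>0 where ut: "2 < u" "u < t" "t < s" and \<epsilon>\<^sub>0: "0 < \<epsilon>\<^sub>0" "\<epsilon>\<^sub>0 < 1"
    and cover: "\<And>\<epsilon>. 0 < \<epsilon> \<Longrightarrow> \<epsilon> \<le> \<epsilon>\<^sub>0 \<Longrightarrow> \<exists>S C. S \<in> sets borel \<and>
      1 - \<epsilon> powr (u\<^sup>2 / (u - 2)) \<le> measure P S \<and> finite C \<and>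
      S \<subseteq> (\<Union>c\<in>C. cball c \<epsilon>) \<and> real (card C) \<le> \<epsilon> powr (- t)"
    using upper_SW1_dim_less_covers[OF assms(5)] by metis
  define e :: "nat \<Rightarrow> real" where "e k = \<epsilon>\<^sub>0 / 4 ^ k" for k
  have e: "0 < e k" "e k \<le> \<epsilon>\<^sub>0" for k using \<epsilon>\<^sub>0 by (auto simp: e_def divide_le_eq)
  have "\<forall>k. \<exists>S C. S \<in> sets borel \<and> 1 - e k powr (u\<^sup>2 / (u - 2)) \<le> measure P S \<and> finite C \<and>
      S \<subseteq> (\<Union>c\<in>C. cball c (e k)) \<and> real (card C) \<le> e k powr (- t)"
    using cover e by blast
  then obtain S C where SC: "\<And>k. S k \<in> sets borel" "\<And>k. 1 - e k powr (u\<^sup>2 / (u - 2)) \<le> measure P (S k)"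
      "\<And>k. finite (C k)" "\<And>k. S k \<subseteq> (\<Union>c\<in>C k. cball c (e k))" "\<And>k. real (card (C k)) \<le> e k powr (- t)"
    by metis
  have "\<exists>f \<in> borel_measurable borel. range f \<subseteq> insert 0 (C k) \<and> (\<forall>x. norm (f x) \<le> norm x + 2 * e k) \<and>
    (\<forall>x. \<forall>c\<in>C k. dist x c \<le> 2 * e k \<longrightarrow> dist x (f x) \<le> dist x c)" for k
    using truncated_nearest_point[OF SC(3)] e(1)[of k] by simp
  then obtain f where f: "\<And>k. f k \<in> borel_measurable borel" "\<And>k. range (f k) \<subseteq> insert 0 (C k)"
      "\<And>k x. norm (f k x) \<le> norm x + 2 * e k"
      "\<And>k x c. c \<in> C k \<Longrightarrow> dist x c \<le> 2 * e k \<Longrightarrow> dist x (f k x) \<le> dist x c"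
    by metis
  \<comment> \<open>Level 0 is collapsed to the origin so that the tree has a single root.\<close>
  define \<rho> where "\<rho> k = (if k = 0 then (\<lambda>_. 0) else f k)" for k
  \<comment> \<open>The function \<open>2 + 4 / (x - 2)\<close> decreases, so passing from
    \<open>s\<close> to the smaller \<open>u\<close> only helps, and
    \<open>2 * u \<le> u\<^sup>2\<close>.\<close>
  have "2 * s / (s - 2) \<le> u\<^sup>2 / (u - 2)"
  proof -
    have "2 * s / (s - 2) = 2 + 4 / (s - 2)" "2 * u / (u - 2) = 2 + 4 / (u - 2)"
      using ut by (auto simp: field_simps)
    moreover have "4 / (s - 2) \<le> 4 / (u - 2)" using ut by (intro divide_left_mono) auto
    moreover have "2 * u / (u - 2) \<le> u\<^sup>2 / (u - 2)"
      using ut by (intro divide_right_mono) (auto simp: power2_eq_square)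
    ultimately show ?thesis by linarith
  qed
  then interpret multiscale_cover P s "enn2real (\<integral>\<^sup>+ x. ennreal (norm x powr s) \<partial>P)" "u\<^sup>2 / (u - 2)" t e S C \<rho>
    by unfold_locales
      (use assms ut \<epsilon>\<^sub>0 SC f e in \<open>auto simp: \<rho>_def e_def less_top intro: add_nonneg_nonneg less_imp_le\<close>)
  show ?thesis by (rule expected_wasserstein1_rate)
qed

end
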